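(* Fix $d>0$, a finite set $\Omega$, an integer $k\geq 3$, a finite nonempty set $\Psi$ of functions $\Omega^k\to(0,\infty)$ and a probability distribution $\rho$ on $\Psi$, and let $\mathbf G_n=\mathbf G_n(d,\Omega,k,\Psi,\rho)$ be the Poisson random factor graph. Assume the static replica symmetry condition $$\lim_{n\to\infty}\frac1{n^2}\sum_{i,j=1}^n\mathbb E\left\|\mu_{\mathbf G_n,x_i,x_j}-\mu_{\mathbf G_n,x_i}\otimes\mu_{\mathbf G_n,x_j}\right\|_{TV}=0 .$$ Then there is a sequence $(\varepsilon_n)_n$ with $\varepsilon_n\to0$ such that, with probability tending to $1$ as $n\to\infty$, the family of messages $(\mu_{\mathbf G_n,x\to a},\mu_{\mathbf G_n,a\to x})_{x\in V(\mathbf G_n),a\in\partial x}$ is an $\varepsilon_n$-Belief Propagation fixed point on $\mathbf G_n$.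
   Context: Factor graphs: Fix a finite set $\Omega$ of spins. A factor graph $G$ consists of a finite set $V(G)$ of variable nodes, a finite set $F(G)$ of constraint nodes, for each $a\in F(G)$ an ordered tuple $\partial a=(y_1,\ldots,y_{d(a)})$ of variable nodes, and a weight function $\psi_a:\Omega^{d(a)}\to(0,\infty)$. For $x\in V(G)$ let $\partial x$ be the set of $a\in F(G)$ with $x$ appearing in $\partial a$; we also write $\partial a$ for the set of variable nodes appearing in the tuple. For $\tau\in\Omega^{\partial a}$ (an assignment of spins to the variables of $\partial a$) write $\psi_a(\tau)=\psi_a(\tau(y_1),\ldots,\tau(y_{d(a)}))$. The Gibbs measure is $\mu_G(\sigma)=Z_G^{-1}\prod_{a\in F(G)}\psi_a(\sigma(\partial a))$ for $\sigma\in\Omega^{V(G)}$, where $Z_G=\sum_{\sigma\in\Omega^{V(G)}}\prod_{a}\psi_a(\sigma(\partial a))$ is the partition function. $\mu_{G,x}$ denotes the marginal distribution of $\sigma(x)$ under $\mu_G$ and $\mu_{G,x,y}$ the joint distribution of $(\sigma(x),\sigma(y))$. For $x\in\partial a$ the message $\mu_{G,x\to a}\in\mathcal P(\Omega)$ is the marginal of $x$ in the Gibbs measure of the factor graph $G-a$ obtained by deleting the constraint node $a$, and $\mu_{G,a\to x}$ is the marginal of $x$ in the Gibbs measure of the factor graph obtained from $G$ by deleting all constraint nodes $b\in\partial x\setminus\{a\}$. $\|\cdot\|_{TV}$ is total variation distance. $\varepsilon$-BP fixed point: For a factor graph $G$ with $n$ variable nodes, the messages form an $\varepsilon$-Belief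 Propagation fixed point if $$\sum_{x\in V(G)}\sum_{a\in\partial x}\sum_{\sigma\in\Omega}\left|\mu_{G,x\to a}(\sigma)-\frac{\prod_{b\in\partial x\setminus a}\mu_{G,b\to x}(\sigma)}{\sum_{\tau\in\Omega}\prod_{b\in\partial x\setminus a}\mu_{G,b\to x}(\tau)}\right|+\left|\mu_{G,a\to x}(\sigma)-\frac{\sum_{\tau\in\Omega^{\partial a}}\mathbf 1\{\tau(x)=\sigma\}\psi_a(\tau)\prod_{y\in\partial a\setminus x}\mu_{G,y\to a}(\tau(y))}{\sum_{\tau\in\Omega^{\partial a}}\psi_a(\tau)\prod_{y\in\partial a\setminus x}\mu_{G,y\to a}(\tau(y))}\right|<\varepsilon n.$$ Poisson random factor graph $\mathbf G_n(d,\Omega,k,\Psi,\rho)$: variable nodes $x_1,\ldots,x_n$; constraint nodes $a_1,\ldots,a_m$ where $m$ is Poisson with mean $dn/k$; independently for each $i$, $\psi_{a_i}\in\Psi$ is drawn from $\rho$ and $\partial a_i$ is a uniformly random $k$-tuple in $\{x_1,\ldots,x_n\}^k$. The parameters $d,\Omega,k,\Psi,\rho$ are fixed as $n\to\infty$. Expectations $\mathbb E$ are over the random factor graph. *)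

theory Defs
  imports "HOL-Probability.Probability"
begin

text \<open>Conventions.
  Spins: a finite type 'o (the finite set Omega).
  A weight function psi : Omega^k -> (0,inf) is a function on spin lists ('o list => real);
  only its values on lists of length k matter.
  A factor graph on the variable nodes x_0,...,x_{n-1} (represented by 0..<n) is a list of
  constraint nodes; constraint node number i is the pair (psi_a, tuple of variable nodes).
  Spin configurations are elements of the PiE set {..<n} ->E UNIV.\<close>

type_synonym 'o weight = "'o list \<Rightarrow> real"
type_synonym 'o fgraph = "('o weight \<times> nat list) list"

definition configs :: "nat \<Rightarrow> (nat \<Rightarrow> 'o) set" where
  "configs n = PiE {..<n} (\<lambda>_. UNIV)"

definition weight_of :: "'o fgraph \<Rightarrow> (nat \<Rightarrow> 'o) \<Rightarrow> real" where
  "weight_of G \<sigma> = prod_list (map (\<lambda>(\<psi>, ys). \<psi> (map \<sigma> ys)) G)"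

definition partition_fun :: "nat \<Rightarrow> 'o fgraph \<Rightarrow> real" where
  "partition_fun n G = (\<Sum>\<sigma>\<in>configs n. weight_of G \<sigma>)"

definition gibbs :: "nat \<Rightarrow> 'o fgraph \<Rightarrow> (nat \<Rightarrow> 'o) \<Rightarrow> real" where
  "gibbs n G \<sigma> = weight_of G \<sigma> / partition_fun n G"

definition marg :: "nat \<Rightarrow> 'o fgraph \<Rightarrow> nat \<Rightarrow> 'o \<Rightarrow> real" where
  "marg n G x s = (\<Sum>\<sigma>\<in>configs n. if \<sigma> x = s then gibbs n G \<sigma> else 0)"

definition marg2 :: "nat \<Rightarrow> 'o fgraph \<Rightarrow> nat \<Rightarrow> nat \<Rightarrow> 'o \<times> 'o \<Rightarrow> real" where
  "marg2 n G x y st = (\<Sum>\<sigma>\<in>configs n. if (\<sigma> x, \<sigma> y) = st then gibbs n G \<sigma> else 0)"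

definition tv_dist :: "('a::finite \<Rightarrow> real) \<Rightarrow> ('a \<Rightarrow> real) \<Rightarrow> real" where
  "tv_dist p q = (\<Sum>z\<in>UNIV. \<bar>p z - q z\<bar>) / 2"

definition adj_var :: "'o fgraph \<Rightarrow> nat \<Rightarrow> nat set" where
  "adj_var G x = {i. i < length G \<and> x \<in> set (snd (G ! i))}"

definition vars_of :: "'o fgraph \<Rightarrow> nat \<Rightarrow> nat set" where
  "vars_of G a = set (snd (G ! a))"

definition del_constraints :: "'o fgraph \<Rightarrow> nat set \<Rightarrow> 'o fgraph" where
  "del_constraints G D = map (\<lambda>i. G ! i) (filter (\<lambda>i. i \<notin> D) [0..<length G])"

definition msg_va :: "nat \<Rightarrow> 'o fgraph \<Rightarrow> nat \<Rightarrow> nat \<Rightarrow> 'o \<Rightarrow> real" where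
  "msg_va n G x a = marg n (del_constraints G {a}) x"

definition msg_av :: "nat \<Rightarrow> 'o fgraph \<Rightarrow> nat \<Rightarrow> nat \<Rightarrow> 'o \<Rightarrow> real" where
  "msg_av n G a x = marg n (del_constraints G (adj_var G x - {a})) x"

definition bp_error :: "nat \<Rightarrow> 'o::finite fgraph \<Rightarrow> real" where
  "bp_error n G =
    (\<Sum>x\<in>{..<n}. \<Sum>a\<in>adj_var G x. \<Sum>s\<in>(UNIV::'o set).
       \<bar>msg_va n G x a s
         - (\<Prod>b\<in>adj_var G x - {a}. msg_av n G b x s)
           / (\<Sum>t\<in>UNIV. \<Prod>b\<in>adj_var G x - {a}. msg_av n G b x t)\<bar>
     + \<bar>msg_av n G a x s
         - (\<Sum>\<tau>\<in>PiE (vars_of G a) (\<lambda>_. UNIV).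
              (if \<tau> x = s then fst (G ! a) (map \<tau> (snd (G ! a))) *
                 (\<Prod>y\<in>vars_of G a - {x}. msg_va n G y a (\<tau> y)) else 0))
           / (\<Sum>\<tau>\<in>PiE (vars_of G a) (\<lambda>_. UNIV).
               fst (G ! a) (map \<tau> (snd (G ! a))) *
                 (\<Prod>y\<in>vars_of G a - {x}. msg_va n G y a (\<tau> y)))\<bar>)"

definition is_eps_BP_fixed_point :: "nat \<Rightarrow> 'o::finite fgraph \<Rightarrow> real \<Rightarrow> bool" where
  "is_eps_BP_fixed_point n G \<epsilon> \<longleftrightarrow> bp_error n G < \<epsilon> * real n"

definition random_tuple :: "nat \<Rightarrow> nat \<Rightarrow> nat list pmf" where
  "random_tuple n k = pmf_of_set {ys. length ys = k \<and> set ys \<subseteq> {..<n}}"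

definition random_fgraph :: "real \<Rightarrow> nat \<Rightarrow> 'o weight pmf \<Rightarrow> nat \<Rightarrow> 'o fgraph pmf" where
  "random_fgraph d k \<rho> n =
     bind_pmf (poisson_pmf (d * real n / real k))
       (\<lambda>m. replicate_pmf m (pair_pmf \<rho> (random_tuple n k)))"

end

theory Submission
  imports Defs
begin

text \<open>
  Fix a variable \<open>x\<close>. In the Poisson model the constraints touching \<open>x\<close> are independent of the
  rest \<open>G\<^sub>0\<close> of the graph, and in \<open>G\<^sub>0\<close> the variable \<open>x\<close> is isolated. Conditioning on the event that no
  constraint touches \<open>x\<close>, which has probability bounded away from 0, shows that \<open>G\<^sub>0\<close> inherits replica
  symmetry. All messages at \<open>x\<close> are averages under \<open>\<mu>\<close>, the Gibbs measure of \<open>G\<^sub>0\<close>, of products of the few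
  weights attached at \<open>x\<close>, and the Belief Propagation equations hold exactly if the other variables in
  these constraints are independent under \<open>\<mu>\<close>. Those variables are uniformly random given \<open>G\<^sub>0\<close>.

  Pairwise decorrelation suffices because of a Bessel-type inequality: if \<open>\<bar>F\<bar> \<le> K\<close>, then the average over
  \<open>y\<close> of \<open>\<bar>Cov\<^sub>\<mu>(F, 1{\<sigma>(y) = t})\<bar>\<close> is at most \<open>K \<surd>\<delta>\<close>, where \<open>\<delta>\<close> is the average absolute pair
  correlation. Peeling off one random variable at a time turns this into approximate independence of
  all of them. The resulting error at \<open>x\<close> is at most \<open>c\<^sup>r \<surd>\<delta>\<close> if \<open>r\<close> constraints touch \<open>x\<close>, which is summable
  against the Poisson weights; Markov's inequality concludes.
\<close>

section \<open>Averages over independent samples and Poisson thinning\<close>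

text \<open>The estimates are stated for an arbitrary bounded observable \<open>F\<close> because
  peeling multiplies \<open>F\<close> by the indicator or weight just removed. Only its sup norm
  matters, so no correlations of higher order than pairs are ever needed. A random constraint
  touches \<open>x\<close> with probability of order 1/n, while the mean number of constraints is
  \<open>l = d * n / k\<close>. The bounds are therefore kept unnormalised: r constraints at
  \<open>x\<close> come with the factor \<open>l ^ r\<close>, each power of \<open>l\<close> paying
  for one touching event, and the \<open>1 / fact r\<close> of the Poisson weight is saved for the
  final summation over r. A second mismatch is that the error involves the square root of the
  average correlation, whereas the hypothesis controls its mean. The inequality between arithmetic
  and geometric mean, with a free parameter \<open>\<eta>\<close>, bridges this gap. Everything
  except the number of constraints is finite, so expectations are finite sums throughout, and the
  Poisson law enters through partial sums.\<close>

definition pavg :: "'a pmf \<Rightarrow> ('a \<Rightarrow> real) \<Rightarrow> real" where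
  "pavg p h = (\<Sum>b\<in>set_pmf p. pmf p b * h b)"

lemma pavg_mono: "(\<And>b. b \<in> set_pmf p \<Longrightarrow> f b \<le> g b) \<Longrightarrow> pavg p f \<le> pavg p g"
  unfolding pavg_def by (intro sum_mono mult_left_mono) auto

lemma pavg_cong: "(\<And>b. b \<in> set_pmf p \<Longrightarrow> f b = g b) \<Longrightarrow> pavg p f = pavg p g"
  unfolding pavg_def by (intro sum.cong) auto

lemma pavg_nonneg: "(\<And>b. b \<in> set_pmf p \<Longrightarrow> 0 \<le> f b) \<Longrightarrow> 0 \<le> pavg p f"
  unfolding pavg_def by (intro sum_nonneg mult_nonneg_nonneg) auto

lemma pavg_add: "pavg p (\<lambda>b. f b + g b) = pavg p f + pavg p g"
  unfolding pavg_def by (simp add: distrib_left sum.distrib)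

lemma pavg_cmult: "pavg p (\<lambda>b. c * f b) = c * pavg p f"
  unfolding pavg_def by (simp add: sum_distrib_left mult_ac)

lemma pavg_cmult_right: "pavg p (\<lambda>b. f b * c) = pavg p f * c"
  using pavg_cmult[of p c f] by (simp only: mult.commute)

text \<open>Finiteness matters here: a sum over an infinite support is 0 by convention, so a
  constant would average to 0.\<close>

lemma pavg_const: "finite (set_pmf p) \<Longrightarrow> pavg p (\<lambda>_. c) = c"
  unfolding pavg_def by (simp add: sum_distrib_right [symmetric] sum_pmf_eq_1)

lemma pavg_sum: "pavg p (\<lambda>b. \<Sum>i\<in>I. f i b) = (\<Sum>i\<in>I. pavg p (f i))"
  unfolding pavg_def by (subst sum.swap) (simp add: sum_distrib_left)

lemma pavg_swap: "pavg p (\<lambda>a. pavg q (\<lambda>b. f a b)) = pavg q (\<lambda>b. pavg p (\<lambda>a. f a b))"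
  unfolding pavg_def sum_distrib_left by (subst sum.swap) (simp add: mult_ac)

primrec lavg :: "'a pmf \<Rightarrow> nat \<Rightarrow> ('a list \<Rightarrow> real) \<Rightarrow> real" where
  "lavg p 0 h = h []"
| "lavg p (Suc r) h = pavg p (\<lambda>b. lavg p r (\<lambda>c. h (b # c)))"

lemma lavg_mono:
  "(\<And>c. length c = r \<Longrightarrow> set c \<subseteq> set_pmf p \<Longrightarrow> f c \<le> g c) \<Longrightarrow> lavg p r f \<le> lavg p r g"
  by (induction r arbitrary: f g) (auto intro!: pavg_mono)

lemma lavg_nonneg:
  "(\<And>c. length c = r \<Longrightarrow> set c \<subseteq> set_pmf p \<Longrightarrow> 0 \<le> f c) \<Longrightarrow> 0 \<le> lavg p r f"
  by (induction r arbitrary: f) (auto intro!: pavg_nonneg)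

lemma lavg_add: "lavg p r (\<lambda>c. f c + g c) = lavg p r f + lavg p r g"
  by (induction r arbitrary: f g) (simp_all add: pavg_add)

lemma lavg_cmult: "lavg p r (\<lambda>b. c * f b) = c * lavg p r f"
  by (induction r arbitrary: f) (simp_all add: pavg_cmult)

lemma lavg_const: "finite (set_pmf p) \<Longrightarrow> lavg p r (\<lambda>_. c) = c"
  by (induction r) (simp_all add: pavg_const)

lemma lavg_sum: "lavg p r (\<lambda>b. \<Sum>i\<in>I. f i b) = (\<Sum>i\<in>I. lavg p r (f i))"
  by (induction r arbitrary: f) (simp_all add: pavg_sum)

lemma pavg_lavg_swap:
  "pavg p (\<lambda>a. lavg q r (\<lambda>c. f a c)) = lavg q r (\<lambda>c. pavg p (\<lambda>a. f a c))"
proof (induction r arbitrary: f)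
  case (Suc r)
  have "pavg p (\<lambda>a. lavg q (Suc r) (\<lambda>c. f a c))
      = pavg q (\<lambda>b. pavg p (\<lambda>a. lavg q r (\<lambda>c. f a (b # c))))"
    by (simp add: pavg_swap[of p q])
  also have "\<dots> = lavg q (Suc r) (\<lambda>c. pavg p (\<lambda>a. f a c))"
    by (simp add: Suc)
  finally show ?case .
qed simp

text \<open>A discrete Palm (Mecke) formula: by exchangeability each of the \<open>Suc r\<close>
  positions contributes equally, and the selected sample is independent of the others.
  \<open>remove1\<close> deletes the first copy of a value rather than the selected position; the
  result is the same up to order, whence the hypothesis \<open>perm\<close>.\<close>

lemma lavg_sum_remove1:
  assumes perm: "\<And>b c c'. mset c = mset c' \<Longrightarrow> h b c = h b c'"
  shows "lavg p (Suc r) (\<lambda>c. \<Sum>b\<leftarrow>c. h b (remove1 b c)) = real (Suc r) * pavg p (\<lambda>b. lavg p r (h b))"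
  using perm
proof (induction r arbitrary: h)
  case 0
  show ?case by simp
next
  case (Suc r)
  have eq: "(\<Sum>b\<leftarrow>b0 # c. h b (remove1 b (b0 # c)))
      = h b0 c + (\<Sum>b\<leftarrow>c. h b (b0 # remove1 b c))" for b0 c
  proof -
    have "h b (remove1 b (b0 # c)) = h b (b0 # remove1 b c)" if "b \<in> set c" for b
      using that by (intro Suc.prems) auto
    then show ?thesis by (auto intro!: arg_cong[of _ _ sum_list])
  qed
  have "lavg p (Suc (Suc r)) (\<lambda>c. \<Sum>b\<leftarrow>c. h b (remove1 b c))
      = pavg p (\<lambda>b0. lavg p (Suc r) (\<lambda>c. h b0 c + (\<Sum>b\<leftarrow>c. h b (b0 # remove1 b c))))"
    by (subst lavg.simps(2)) (simp only: eq)
  also have "\<dots> = pavg p (\<lambda>b0. lavg p (Suc r) (h b0))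
      + pavg p (\<lambda>b0. lavg p (Suc r) (\<lambda>c. \<Sum>b\<leftarrow>c. h b (b0 # remove1 b c)))"
    by (simp only: lavg_add pavg_add)
  also have "pavg p (\<lambda>b0. lavg p (Suc r) (\<lambda>c. \<Sum>b\<leftarrow>c. h b (b0 # remove1 b c)))
      = pavg p (\<lambda>b0. real (Suc r) * pavg p (\<lambda>b. lavg p r (\<lambda>c. h b (b0 # c))))"
    by (subst Suc.IH) (auto intro!: Suc.prems)
  also have "\<dots> = real (Suc r) * pavg p (\<lambda>b. lavg p (Suc r) (h b))"
    by (subst pavg_cmult, subst pavg_swap) simp
  finally show ?case by (simp add: algebra_simps)
qed

section \<open>Binomial splitting and Poisson thinning\<close>

definition thinned :: "'a pmf \<Rightarrow> ('a \<Rightarrow> bool) \<Rightarrow> ('a list \<Rightarrow> 'a list \<Rightarrow> real) \<Rightarrow> nat \<Rightarrow> nat \<Rightarrow> real" where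
  "thinned p Q \<Phi> r q = lavg p q (\<lambda>G. of_bool (\<forall>b\<in>set G. \<not> Q b) *
     lavg p r (\<lambda>c. of_bool (\<forall>b\<in>set c. Q b) * \<Phi> c G))"

lemma thinned_Suc_left:
  "pavg p (\<lambda>b. of_bool (Q b) * thinned p Q (\<lambda>c. \<Phi> (b # c)) r q) = thinned p Q \<Phi> (Suc r) q"
  unfolding thinned_def lavg_cmult[symmetric]
  by (subst pavg_lavg_swap) (simp add: lavg_cmult pavg_cmult[symmetric] of_bool_conj mult_ac)

lemma thinned_Suc_right:
  "pavg p (\<lambda>b. of_bool (\<not> Q b) * thinned p Q (\<lambda>c G. \<Phi> c (b # G)) r q) = thinned p Q \<Phi> r (Suc q)"
  unfolding thinned_def lavg_cmult[symmetric]
  by (simp add: of_bool_conj mult_ac)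

lemma pascal_sum:
  fixes f :: "nat \<Rightarrow> nat \<Rightarrow> real"
  shows "(\<Sum>r\<le>Suc m. (Suc m choose r) * f r (Suc m - r))
       = (\<Sum>r\<le>m. (m choose r) * f (Suc r) (m - r)) + (\<Sum>r\<le>m. (m choose r) * f r (Suc (m - r)))"
proof -
  have "(\<Sum>r\<le>m. (m choose r) * f r (Suc (m - r))) = (\<Sum>r\<le>m. (m choose r) * f r (Suc m - r))"
    by (intro sum.cong) (auto simp: Suc_diff_le)
  also have "\<dots> = (\<Sum>r\<le>Suc m. (m choose r) * f r (Suc m - r))" by simp
  also have "\<dots> = f 0 (Suc m) + (\<Sum>r\<le>m. (m choose Suc r) * f (Suc r) (m - r))"
    by (subst sum.atMost_Suc_shift) simp
  finally show ?thesis
    by (subst sum.atMost_Suc_shift) (simp add: sum.distrib algebra_simps)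
qed

text \<open>Filtering forgets how the two sublists interleave, so all position patterns of equal
  size contribute alike. Formally, the first sample goes to one side or the other, and Pascal's rule
  solves the recursion.\<close>

lemma lavg_filter:
  "lavg p m (\<lambda>G. \<Phi> (filter Q G) (filter (\<lambda>b. \<not> Q b) G))
   = (\<Sum>r\<le>m. (m choose r) * thinned p Q \<Phi> r (m - r))"
proof (induction m arbitrary: \<Phi>)
  case 0
  show ?case by (simp add: thinned_def)
next
  case (Suc m)
  let ?L = "\<lambda>\<Phi>. lavg p m (\<lambda>G. \<Phi> (filter Q G) (filter (\<lambda>b. \<not> Q b) G))"
  have "lavg p (Suc m) (\<lambda>G. \<Phi> (filter Q G) (filter (\<lambda>b. \<not> Q b) G))
     = pavg p (\<lambda>b. of_bool (Q b) * ?L (\<lambda>c. \<Phi> (b # c)) + of_bool (\<not> Q b) * ?L (\<lambda>c G. \<Phi> c (b # G)))"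
    unfolding lavg.simps by (intro pavg_cong) auto
  also have "\<dots> = (\<Sum>r\<le>m. (m choose r) * pavg p (\<lambda>b. of_bool (Q b) * thinned p Q (\<lambda>c. \<Phi> (b # c)) r (m - r)))
     + (\<Sum>r\<le>m. (m choose r) * pavg p (\<lambda>b. of_bool (\<not> Q b) * thinned p Q (\<lambda>c G. \<Phi> c (b # G)) r (m - r)))"
    unfolding Suc.IH[of "\<lambda>c. \<Phi> (_ # c)"] Suc.IH[of "\<lambda>c G. \<Phi> c (_ # G)"]
      pavg_add sum_distrib_left pavg_sum pavg_cmult[symmetric]
    by (simp only: mult.left_commute)
  also have "\<dots> = (\<Sum>r\<le>Suc m. (Suc m choose r) * thinned p Q \<Phi> r (Suc m - r))"
    unfolding thinned_Suc_left thinned_Suc_right pascal_sum ..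
  finally show ?case .
qed

text \<open>On the right \<open>\<Delta>\<close> is averaged over the whole Poisson sample rather than over its part outside \<open>Q\<close>: a sample
  of that part is a sample of the whole on the event that nothing satisfies \<open>Q\<close>.\<close>

lemma poisson_thinning_bound:
  fixes \<Phi> :: "'a list \<Rightarrow> 'a list \<Rightarrow> real" and \<Delta> :: "'a list \<Rightarrow> real"
  assumes lam: "l \<ge> 0"
    and \<Phi>: "\<And>c G. \<Phi> c G \<ge> 0" and \<Delta>: "\<And>G. set G \<subseteq> set_pmf p \<Longrightarrow> \<Delta> G \<ge> 0"
    and bnd: "\<And>r G. set G \<subseteq> set_pmf p \<Longrightarrow> \<forall>b\<in>set G. \<not> Q b \<Longrightarrow>
        l ^ r * lavg p r (\<lambda>c. of_bool (\<forall>b\<in>set c. Q b) * \<Phi> c G) \<le> a r * \<Delta> G"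
    and a: "\<And>r. a r \<ge> 0" and K: "\<And>N. (\<Sum>r<N. a r / fact r) \<le> K"
  shows "(\<Sum>m<N. l ^ m / fact m * lavg p m (\<lambda>G. \<Phi> (filter Q G) (filter (\<lambda>b. \<not> Q b) G)))
     \<le> K * (\<Sum>m<N. l ^ m / fact m * lavg p m \<Delta>)"
proof -
  \<comment> \<open>\<open>l ^ m / fact m\<close> times \<open>m choose r\<close> is the product of
    the weights of \<open>r\<close> and \<open>m - r\<close>; this is the independence of the two
    parts of a Poisson sample.\<close>
  define t where "t r q = l ^ r / fact r * (l ^ q / fact q) * thinned p Q \<Phi> r q" for r q
  have t0: "t r q \<ge> 0" for r q
    unfolding t_def thinned_def using lam \<Phi> by (intro mult_nonneg_nonneg lavg_nonneg divide_nonneg_nonneg) auto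
  have tb: "t r q \<le> a r / fact r * (l ^ q / fact q * lavg p q \<Delta>)" for r q
  proof -
    have "l ^ r * thinned p Q \<Phi> r q
        = lavg p q (\<lambda>G. of_bool (\<forall>b\<in>set G. \<not> Q b) *
            (l ^ r * lavg p r (\<lambda>c. of_bool (\<forall>b\<in>set c. Q b) * \<Phi> c G)))"
      unfolding thinned_def lavg_cmult[symmetric] by (simp add: mult_ac)
    also have "\<dots> \<le> lavg p q (\<lambda>G. a r * \<Delta> G)"
      using bnd \<Delta> a by (intro lavg_mono) auto
    finally have "l ^ r * thinned p Q \<Phi> r q \<le> a r * lavg p q \<Delta>" by (simp add: lavg_cmult)
    then have "(l ^ r * thinned p Q \<Phi> r q) * (l ^ q / (fact r * fact q))
        \<le> (a r * lavg p q \<Delta>) * (l ^ q / (fact r * fact q))"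
      using lam by (intro mult_right_mono) auto
    then show ?thesis by (simp add: t_def mult_ac)
  qed
  have "(\<Sum>m<N. l ^ m / fact m * lavg p m (\<lambda>G. \<Phi> (filter Q G) (filter (\<lambda>b. \<not> Q b) G)))
      = (\<Sum>m<N. \<Sum>r\<le>m. t r (m - r))"
  proof (intro sum.cong refl)
    fix m
    have "l ^ m / fact m * ((m choose r) * thinned p Q \<Phi> r (m - r)) = t r (m - r)" if "r \<le> m" for r
      using that by (simp add: t_def binomial_fact power_add[symmetric])
    then show "l ^ m / fact m * lavg p m (\<lambda>G. \<Phi> (filter Q G) (filter (\<lambda>b. \<not> Q b) G)) = (\<Sum>r\<le>m. t r (m - r))"
      unfolding lavg_filter sum_distrib_left by (intro sum.cong) auto
  qed
  also have "\<dots> = (\<Sum>(r, q)\<in>{(r, q). r + q < N}. t r q)"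
    by (rule sum.triangle_reindex[symmetric])
  \<comment> \<open>Enlarging the triangle to a square only adds nonnegative terms, and it decouples
    the two sums.\<close>
  also have "\<dots> \<le> (\<Sum>(r, q)\<in>{..<N} \<times> {..<N}. t r q)"
    using t0 by (intro sum_mono2) auto
  also have "\<dots> = (\<Sum>r<N. \<Sum>q<N. t r q)" by (simp add: sum.cartesian_product)
  also have "\<dots> \<le> (\<Sum>r<N. \<Sum>q<N. a r / fact r * (l ^ q / fact q * lavg p q \<Delta>))"
    by (intro sum_mono tb)
  also have "\<dots> = (\<Sum>r<N. a r / fact r) * (\<Sum>m<N. l ^ m / fact m * lavg p m \<Delta>)"
    by (simp add: sum_product)
  also have "\<dots> \<le> K * (\<Sum>m<N. l ^ m / fact m * lavg p m \<Delta>)"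
    using lam \<Delta> K by (intro mult_right_mono sum_nonneg mult_nonneg_nonneg lavg_nonneg) auto
  finally show ?thesis .
qed

section \<open>Decorrelation on average\<close>

lemma finite_configs: "finite (configs n :: (nat \<Rightarrow> 'o::finite) set)"
  unfolding configs_def by (intro finite_PiE) auto

lemma sum_PiE_insert:
  assumes "y \<notin> Y"
  shows "(\<Sum>\<tau>\<in>PiE (insert y Y) (\<lambda>_. UNIV). h \<tau>)
       = (\<Sum>t\<in>UNIV. \<Sum>\<tau>\<in>PiE Y (\<lambda>_. UNIV). h (\<tau>(y := t)))"
  unfolding PiE_insert_eq using inj_combinator[OF assms, of "\<lambda>_. UNIV"]
  by (subst sum.reindex) (simp_all add: sum.cartesian_product case_prod_unfold)

locale config_measure =
  fixes n :: nat and p :: "(nat \<Rightarrow> 'o::finite) \<Rightarrow> real"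
  assumes p_nonneg: "\<And>\<sigma>. \<sigma> \<in> configs n \<Longrightarrow> p \<sigma> \<ge> 0"
    and p_sum: "(\<Sum>\<sigma>\<in>configs n. p \<sigma>) = 1"
    and n_pos: "n > 0"
begin

definition ex :: "((nat \<Rightarrow> 'o) \<Rightarrow> real) \<Rightarrow> real" where
  "ex f = (\<Sum>\<sigma>\<in>configs n. p \<sigma> * f \<sigma>)"

definition cov :: "((nat \<Rightarrow> 'o) \<Rightarrow> real) \<Rightarrow> ((nat \<Rightarrow> 'o) \<Rightarrow> real) \<Rightarrow> real" where
  "cov f g = ex (\<lambda>\<sigma>. f \<sigma> * g \<sigma>) - ex f * ex g"

definition spin :: "nat \<Rightarrow> 'o \<Rightarrow> (nat \<Rightarrow> 'o) \<Rightarrow> real" where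
  "spin y t \<sigma> = of_bool (\<sigma> y = t)"

definition corr :: real where
  "corr = (\<Sum>i<n. \<Sum>j<n. \<Sum>s\<in>UNIV. \<Sum>t\<in>UNIV. \<bar>cov (spin i s) (spin j t)\<bar>) / (real n)\<^sup>2"

lemma ex_mono: "(\<And>\<sigma>. \<sigma> \<in> configs n \<Longrightarrow> f \<sigma> \<le> g \<sigma>) \<Longrightarrow> ex f \<le> ex g"
  unfolding ex_def by (intro sum_mono mult_left_mono p_nonneg) auto

lemma ex_cong: "(\<And>\<sigma>. \<sigma> \<in> configs n \<Longrightarrow> f \<sigma> = g \<sigma>) \<Longrightarrow> ex f = ex g"
  unfolding ex_def by (intro sum.cong) auto

lemma ex_add: "ex (\<lambda>\<sigma>. f \<sigma> + g \<sigma>) = ex f + ex g"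
  unfolding ex_def by (simp add: distrib_left sum.distrib)

lemma ex_diff: "ex (\<lambda>\<sigma>. f \<sigma> - g \<sigma>) = ex f - ex g"
  unfolding ex_def by (simp add: right_diff_distrib sum_subtractf)

lemma ex_cmult: "ex (\<lambda>\<sigma>. c * f \<sigma>) = c * ex f"
  unfolding ex_def by (simp add: sum_distrib_left mult_ac)

lemma ex_cmult_right: "ex (\<lambda>\<sigma>. f \<sigma> * c) = ex f * c"
  unfolding ex_def by (simp add: sum_distrib_left mult_ac)

lemma ex_const: "ex (\<lambda>_. c) = c"
  unfolding ex_def by (simp add: sum_distrib_right[symmetric] p_sum)

lemma ex_sum: "ex (\<lambda>\<sigma>. \<Sum>i\<in>I. f i \<sigma>) = (\<Sum>i\<in>I. ex (f i))"
  unfolding ex_def by (subst sum.swap) (simp add: sum_distrib_left)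

lemma ex_bounds:
  assumes "\<And>\<sigma>. \<sigma> \<in> configs n \<Longrightarrow> a \<le> f \<sigma>" "\<And>\<sigma>. \<sigma> \<in> configs n \<Longrightarrow> f \<sigma> \<le> b"
  shows "a \<le> ex f" "ex f \<le> b"
  using ex_mono[of "\<lambda>_. a" f] ex_mono[of f "\<lambda>_. b"] assms by (auto simp: ex_const)

lemma abs_ex_le:
  assumes "\<And>\<sigma>. \<sigma> \<in> configs n \<Longrightarrow> \<bar>f \<sigma>\<bar> \<le> K"
  shows "\<bar>ex f\<bar> \<le> K"
  using ex_bounds[of "- K" f K] assms by (force simp: abs_le_iff)

text \<open>Cauchy-Schwarz, read off from the nonnegative variance of the absolute value of
  \<open>f\<close>.\<close>

lemma ex_abs_le_sqrt: "ex (\<lambda>\<sigma>. \<bar>f \<sigma>\<bar>) \<le> sqrt (ex (\<lambda>\<sigma>. (f \<sigma>)\<^sup>2))"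
proof (rule real_le_rsqrt)
  let ?m = "ex (\<lambda>\<sigma>. \<bar>f \<sigma>\<bar>)"
  have "0 \<le> ex (\<lambda>\<sigma>. (\<bar>f \<sigma>\<bar> - ?m)\<^sup>2)"
    using ex_mono[of "\<lambda>_. 0"] by (simp add: ex_const)
  also have "(\<lambda>\<sigma>. (\<bar>f \<sigma>\<bar> - ?m)\<^sup>2) = (\<lambda>\<sigma>. (f \<sigma>)\<^sup>2 + (?m\<^sup>2 - (2 * ?m) * \<bar>f \<sigma>\<bar>))"
    by (simp add: power2_diff fun_eq_iff)
  also have "ex \<dots> = ex (\<lambda>\<sigma>. (f \<sigma>)\<^sup>2) + (?m\<^sup>2 - 2 * ?m * ?m)"
    by (simp only: ex_add ex_diff ex_cmult ex_const)
  finally show "?m\<^sup>2 \<le> ex (\<lambda>\<sigma>. (f \<sigma>)\<^sup>2)" by (simp add: power2_eq_square)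
qed

lemma corr_nonneg: "corr \<ge> 0"
  unfolding corr_def by (intro divide_nonneg_nonneg sum_nonneg) auto

lemma sum_cov_le_corr: "(\<Sum>i<n. \<Sum>j<n. \<bar>cov (spin i t) (spin j t)\<bar>) \<le> (real n)\<^sup>2 * corr"
proof -
  have "\<bar>cov (spin i t) (spin j t)\<bar> \<le> (\<Sum>s\<in>UNIV. \<Sum>t\<in>UNIV. \<bar>cov (spin i s) (spin j t)\<bar>)" for i j
  proof -
    have "\<bar>cov (spin i t) (spin j t)\<bar> \<le> (\<Sum>t'\<in>UNIV. \<bar>cov (spin i t) (spin j t')\<bar>)"
      by (rule member_le_sum[of t UNIV "\<lambda>t'. \<bar>cov (spin i t) (spin j t')\<bar>"]) auto
    also have "\<dots> \<le> (\<Sum>s\<in>UNIV. \<Sum>t\<in>UNIV. \<bar>cov (spin i s) (spin j t)\<bar>)"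
      by (rule member_le_sum[of t UNIV "\<lambda>s. \<Sum>t'\<in>UNIV. \<bar>cov (spin i s) (spin j t')\<bar>"])
        (auto intro: sum_nonneg)
    finally show ?thesis .
  qed
  then show ?thesis unfolding corr_def using n_pos by (simp add: sum_mono)
qed

lemma bound_nonneg:
  fixes F :: "(nat \<Rightarrow> 'o) \<Rightarrow> real"
  assumes F: "\<And>\<sigma>. \<sigma> \<in> configs n \<Longrightarrow> \<bar>F \<sigma>\<bar> \<le> K"
  shows "K \<ge> 0"
proof -
  obtain \<sigma> :: "nat \<Rightarrow> 'o" where "\<sigma> \<in> configs n"
    using p_sum by (cases "configs n = ({} :: (nat \<Rightarrow> 'o) set)") auto
  then have "\<bar>F \<sigma>\<bar> \<le> K" by (rule F)
  then show ?thesis by linarith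
qed

text \<open>With the signs of the covariances as coefficients, the sum is the expectation of
  \<open>F\<close> times one centred variable \<open>S\<close>. The second moment of
  \<open>S\<close> involves pair covariances only, so \<open>F\<close> enters solely through its
  bound.\<close>

lemma bessel:
  assumes F: "\<And>\<sigma>. \<sigma> \<in> configs n \<Longrightarrow> \<bar>F \<sigma>\<bar> \<le> K"
  shows "(\<Sum>y<n. \<bar>cov F (spin y t)\<bar>) \<le> real n * (K * sqrt corr)"
proof -
  define a where "a y = sgn (cov F (spin y t))" for y
  define S where "S \<sigma> = (\<Sum>y<n. a y * (spin y t \<sigma> - ex (spin y t)))" for \<sigma>
  have a1: "\<bar>a y\<bar> \<le> 1" for y unfolding a_def by (simp add: sgn_if)
  have K: "K \<ge> 0" by (rule bound_nonneg) (rule F)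
  have "(\<Sum>y<n. \<bar>cov F (spin y t)\<bar>) = (\<Sum>y<n. a y * cov F (spin y t))"
    unfolding a_def by (simp add: abs_sgn mult.commute)
  also have "\<dots> = ex (\<lambda>\<sigma>. F \<sigma> * S \<sigma>)"
  proof -
    have "ex (\<lambda>\<sigma>. F \<sigma> * S \<sigma>)
        = ex (\<lambda>\<sigma>. \<Sum>y<n. a y * (F \<sigma> * spin y t \<sigma> - ex (spin y t) * F \<sigma>))"
      unfolding S_def sum_distrib_left by (intro ex_cong sum.cong) (auto simp: algebra_simps)
    then show ?thesis by (simp only: ex_sum ex_cmult ex_diff cov_def mult.commute[of "ex F"])
  qed
  also have "\<dots> \<le> ex (\<lambda>\<sigma>. K * \<bar>S \<sigma>\<bar>)"
  proof (intro ex_mono)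
    fix \<sigma> :: "nat \<Rightarrow> 'o" assume "\<sigma> \<in> configs n"
    then have "\<bar>F \<sigma> * S \<sigma>\<bar> \<le> K * \<bar>S \<sigma>\<bar>" unfolding abs_mult by (intro mult_right_mono F) auto
    then show "F \<sigma> * S \<sigma> \<le> K * \<bar>S \<sigma>\<bar>" by linarith
  qed
  also have "\<dots> = K * ex (\<lambda>\<sigma>. \<bar>S \<sigma>\<bar>)" by (rule ex_cmult)
  also have "\<dots> \<le> K * sqrt (ex (\<lambda>\<sigma>. (S \<sigma>)\<^sup>2))"
    by (intro mult_left_mono ex_abs_le_sqrt K)
  finally have 1: "(\<Sum>y<n. \<bar>cov F (spin y t)\<bar>) \<le> K * sqrt (ex (\<lambda>\<sigma>. (S \<sigma>)\<^sup>2))" .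
  have "ex (\<lambda>\<sigma>. (S \<sigma>)\<^sup>2) = (\<Sum>i<n. \<Sum>j<n. a i * a j * cov (spin i t) (spin j t))"
  proof -
    have "(S \<sigma>)\<^sup>2 = (\<Sum>i<n. \<Sum>j<n. a i * a j * ((spin i t \<sigma> * spin j t \<sigma> - ex (spin j t) * spin i t \<sigma>)
        - (ex (spin i t) * spin j t \<sigma> - ex (spin i t) * ex (spin j t))))" for \<sigma>
      unfolding S_def power2_eq_square sum_product by (intro sum.cong refl) (simp add: algebra_simps)
    then show ?thesis
      by (simp only: ex_sum ex_cmult ex_diff ex_const cov_def mult.commute[of "ex (spin _ t)" "ex (spin _ t)"]) simp
  qed
  also have "\<dots> \<le> (\<Sum>i<n. \<Sum>j<n. \<bar>cov (spin i t) (spin j t)\<bar>)"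
  proof (intro sum_mono)
    fix i j
    have "\<bar>a i * a j\<bar> \<le> 1" using a1 by (simp add: abs_mult mult_le_one)
    then have "\<bar>a i * a j * cov (spin i t) (spin j t)\<bar> \<le> 1 * \<bar>cov (spin i t) (spin j t)\<bar>"
      unfolding abs_mult[of "a i * a j"] by (intro mult_right_mono) auto
    then show "a i * a j * cov (spin i t) (spin j t) \<le> \<bar>cov (spin i t) (spin j t)\<bar>" by linarith
  qed
  also have "\<dots> \<le> (real n)\<^sup>2 * corr" by (rule sum_cov_le_corr)
  finally have "sqrt (ex (\<lambda>\<sigma>. (S \<sigma>)\<^sup>2)) \<le> real n * sqrt corr"
    by (metis real_sqrt_le_iff real_sqrt_mult real_sqrt_abs abs_of_nat)
  then have "K * sqrt (ex (\<lambda>\<sigma>. (S \<sigma>)\<^sup>2)) \<le> K * (real n * sqrt corr)"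
    by (rule mult_left_mono) (rule K)
  then show ?thesis using 1 by (simp add: mult.left_commute)
qed

text \<open>The spin at \<open>x\<close> is pinned to \<open>s\<close>, so the coordinates of a random tuple that equal \<open>x\<close> are
  deterministic and cause no error.\<close>

definition pspin :: "nat \<Rightarrow> 'o \<Rightarrow> nat \<Rightarrow> 'o \<Rightarrow> (nat \<Rightarrow> 'o) \<Rightarrow> real" where
  "pspin x s y t \<sigma> = of_bool ((\<sigma>(x := s)) y = t)"

definition dev1 :: "nat \<Rightarrow> 'o \<Rightarrow> ((nat \<Rightarrow> 'o) \<Rightarrow> real) \<Rightarrow> nat \<Rightarrow> real" where
  "dev1 x s F y = (\<Sum>t\<in>UNIV. \<bar>cov F (pspin x s y t)\<bar>)"

text \<open>An L1 distance between the law of the pinned spins on \<open>Y\<close>, weighted by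
  \<open>F\<close>, and the product of their marginals. \<open>Y\<close> is a set, so that a
  variable repeated in a tuple counts once.\<close>

definition dev :: "nat \<Rightarrow> 'o \<Rightarrow> ((nat \<Rightarrow> 'o) \<Rightarrow> real) \<Rightarrow> nat set \<Rightarrow> real" where
  "dev x s F Y = (\<Sum>\<tau>\<in>PiE Y (\<lambda>_. UNIV).
     \<bar>ex (\<lambda>\<sigma>. F \<sigma> * of_bool (\<forall>y\<in>Y. (\<sigma>(x := s)) y = \<tau> y)) - ex F * (\<Prod>y\<in>Y. ex (pspin x s y (\<tau> y)))\<bar>)"

lemma dev_nonneg: "dev x s F Y \<ge> 0"
  unfolding dev_def by (intro sum_nonneg) auto

lemma dev1_nonneg: "dev1 x s F y \<ge> 0"
  unfolding dev1_def by (intro sum_nonneg) auto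

lemma dev_empty [simp]: "dev x s F {} = 0"
  by (simp add: dev_def)

lemma pspin_nonneg: "pspin x s y t \<sigma> \<ge> 0"
  by (simp add: pspin_def)

lemma sum_pspin: "(\<Sum>t\<in>UNIV. pspin x s y t \<sigma>) = 1"
  by (simp add: pspin_def of_bool_def)

lemma ex_pspin_nonneg: "ex (pspin x s y t) \<ge> 0"
  using ex_mono[of "\<lambda>_. 0" "pspin x s y t"] by (simp add: ex_const pspin_nonneg)

lemma sum_ex_pspin: "(\<Sum>t\<in>UNIV. ex (pspin x s y t)) = 1"
  by (simp add: ex_sum[symmetric] sum_pspin ex_const)

lemma dev1_self: "dev1 x s F x = 0"
  by (simp add: dev1_def cov_def pspin_def[abs_def] ex_const ex_cmult_right)

lemma dev1_le:
  assumes F: "\<And>\<sigma>. \<sigma> \<in> configs n \<Longrightarrow> \<bar>F \<sigma>\<bar> \<le> K"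
  shows "(\<Sum>y<n. dev1 x s F y) \<le> real n * (CARD('o) * (K * sqrt corr))"
proof -
  have "dev1 x s F y \<le> (\<Sum>t\<in>UNIV. \<bar>cov F (spin y t)\<bar>)" for y
  proof (cases "y = x")
    case True
    then show ?thesis by (simp add: dev1_self sum_nonneg)
  next
    case False
    then have "pspin x s y t = spin y t" for t by (auto simp: pspin_def spin_def)
    then show ?thesis by (simp add: dev1_def)
  qed
  then have "(\<Sum>y<n. dev1 x s F y) \<le> (\<Sum>y<n. \<Sum>t\<in>UNIV. \<bar>cov F (spin y t)\<bar>)"
    by (intro sum_mono)
  also have "\<dots> = (\<Sum>t\<in>UNIV. \<Sum>y<n. \<bar>cov F (spin y t)\<bar>)" by (rule sum.swap)
  also have "\<dots> \<le> (\<Sum>t\<in>(UNIV::'o set). real n * (K * sqrt corr))"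
    by (intro sum_mono bessel F)
  finally show ?thesis by (simp add: mult_ac)
qed

text \<open>Peeling: \<open>F\<close> is the sum of the pieces \<open>F * pspin x s y t\<close> over
  \<open>t\<close>. Replacing the expectation of each piece by a product costs one covariance; what
  is left is the same problem on \<open>Y\<close> with the pieces as observables.\<close>

lemma dev_insert:
  assumes "finite Y"
  shows "dev x s F (insert y Y) \<le> dev1 x s F y + (\<Sum>t\<in>UNIV. dev x s (\<lambda>\<sigma>. F \<sigma> * pspin x s y t \<sigma>) Y)"
proof (cases "y \<in> Y")
  case True
  \<comment> \<open>A repeated variable does not change the set, so it suffices to split
    \<open>F\<close> by the spin at \<open>y\<close> and use the triangle inequality.\<close>
  have split: "ex (\<lambda>\<sigma>. F \<sigma> * h \<sigma>) = (\<Sum>t\<in>UNIV. ex (\<lambda>\<sigma>. F \<sigma> * pspin x s y t \<sigma> * h \<sigma>))" for h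
    unfolding ex_sum[symmetric] sum_distrib_right[symmetric] sum_distrib_left[symmetric]
    by (simp add: sum_pspin)
  have split1: "ex F = (\<Sum>t\<in>UNIV. ex (\<lambda>\<sigma>. F \<sigma> * pspin x s y t \<sigma>))"
    using split[of "\<lambda>_. 1"] by simp
  have "dev x s F Y \<le> (\<Sum>\<tau>\<in>PiE Y (\<lambda>_. UNIV). \<Sum>t\<in>UNIV.
     \<bar>ex (\<lambda>\<sigma>. F \<sigma> * pspin x s y t \<sigma> * of_bool (\<forall>y\<in>Y. (\<sigma>(x := s)) y = \<tau> y))
       - ex (\<lambda>\<sigma>. F \<sigma> * pspin x s y t \<sigma>) * (\<Prod>y\<in>Y. ex (pspin x s y (\<tau> y)))\<bar>)"
    unfolding dev_def
    by (intro sum_mono, subst split, subst split1)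
       (simp only: sum_distrib_right sum_subtractf[symmetric] sum_abs)
  also have "\<dots> = (\<Sum>t\<in>UNIV. dev x s (\<lambda>\<sigma>. F \<sigma> * pspin x s y t \<sigma>) Y)"
    unfolding dev_def by (rule sum.swap)
  also have "\<dots> \<le> dev1 x s F y + \<dots>" by (simp add: dev1_nonneg)
  finally show ?thesis using True by (simp add: insert_absorb)
next
  case False
  let ?X = "\<lambda>\<tau>. \<Prod>y\<in>Y. ex (pspin x s y (\<tau> y))"
  let ?I = "\<lambda>\<tau> \<sigma>. of_bool (\<forall>z\<in>Y. (\<sigma>(x := s)) z = \<tau> z) :: real"
  let ?c = "\<lambda>t. cov F (pspin x s y t)"
  \<comment> \<open>The product measure on \<open>Y\<close> has mass one, so each covariance is
    charged only once although many assignments remain.\<close>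
  have one: "(\<Sum>\<tau>\<in>PiE Y (\<lambda>_. UNIV). ?X \<tau>) = 1"
    using prod_sum_PiE[of Y "\<lambda>_. UNIV" "\<lambda>y t. ex (pspin x s y t)"] assms by (simp add: sum_ex_pspin)
  have X0: "?X \<tau> \<ge> 0" for \<tau> by (intro prod_nonneg) (simp add: ex_pspin_nonneg)
  have "dev x s F (insert y Y) = (\<Sum>t\<in>UNIV. \<Sum>\<tau>\<in>PiE Y (\<lambda>_. UNIV).
     \<bar>ex (\<lambda>\<sigma>. F \<sigma> * pspin x s y t \<sigma> * ?I \<tau> \<sigma>) - ex F * (ex (pspin x s y t) * ?X \<tau>)\<bar>)"
  proof -
    have 1: "of_bool (\<forall>z\<in>insert y Y. (\<sigma>(x := s)) z = (\<tau>(y := t)) z) = pspin x s y t \<sigma> * ?I \<tau> \<sigma>" for \<sigma> \<tau> t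
      using False by (auto simp: pspin_def)
    have 2: "(\<Prod>z\<in>insert y Y. ex (pspin x s z ((\<tau>(y := t)) z))) = ex (pspin x s y t) * ?X \<tau>" for \<tau> t
      using False assms by (subst prod.insert) (auto intro!: prod.cong)
    show ?thesis unfolding dev_def sum_PiE_insert[OF False] 1 2 by (simp only: mult.assoc)
  qed
  also have "\<dots> \<le> (\<Sum>t\<in>UNIV. \<Sum>\<tau>\<in>PiE Y (\<lambda>_. UNIV).
     \<bar>ex (\<lambda>\<sigma>. F \<sigma> * pspin x s y t \<sigma> * ?I \<tau> \<sigma>) - ex (\<lambda>\<sigma>. F \<sigma> * pspin x s y t \<sigma>) * ?X \<tau>\<bar> + \<bar>?c t\<bar> * ?X \<tau>)"
  proof (intro sum_mono)
    fix t \<tau>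
    have "\<bar>?c t\<bar> * ?X \<tau> = \<bar>?c t * ?X \<tau>\<bar>" using X0 by (simp add: abs_mult)
    then show "\<bar>ex (\<lambda>\<sigma>. F \<sigma> * pspin x s y t \<sigma> * ?I \<tau> \<sigma>) - ex F * (ex (pspin x s y t) * ?X \<tau>)\<bar>
      \<le> \<bar>ex (\<lambda>\<sigma>. F \<sigma> * pspin x s y t \<sigma> * ?I \<tau> \<sigma>) - ex (\<lambda>\<sigma>. F \<sigma> * pspin x s y t \<sigma>) * ?X \<tau>\<bar> + \<bar>?c t\<bar> * ?X \<tau>"
      by (simp add: cov_def algebra_simps)
  qed
  also have "\<dots> = (\<Sum>t\<in>UNIV. dev x s (\<lambda>\<sigma>. F \<sigma> * pspin x s y t \<sigma>) Y) + dev1 x s F y"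
    unfolding sum.distrib sum_distrib_left[symmetric] one by (simp add: dev_def dev1_def)
  finally show ?thesis by simp
qed

end

section \<open>Uniformly random tuples\<close>

lemma pavg_uniform: "n > 0 \<Longrightarrow> pavg (pmf_of_set {..<n}) h = (\<Sum>y<n. h y) / real n"
  by (simp add: pavg_def set_pmf_of_set sum_divide_distrib lessThan_empty_iff)

lemma finite_set_uniform: "n > 0 \<Longrightarrow> finite (set_pmf (pmf_of_set {..<n::nat}))"
  by (simp add: set_pmf_of_set lessThan_empty_iff)

text \<open>A union bound: \<open>x\<close> is the first coordinate, which has probability
  \<open>1 / n\<close>, or it occurs later. The factor \<open>n\<close> cancels this probability and
  keeps the bounds free of \<open>n\<close>.\<close>

lemma tuple_hit_Suc:
  assumes x: "x < n" and D: "\<And>ys. D ys \<ge> 0"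
  defines "U \<equiv> pmf_of_set {..<n::nat}"
  shows "n * lavg U (Suc k) (\<lambda>ys. of_bool (x \<in> set ys) * D ys)
     \<le> lavg U k (\<lambda>ys. D (x # ys)) + pavg U (\<lambda>y. n * lavg U k (\<lambda>ys. of_bool (x \<in> set ys) * D (y # ys)))"
proof -
  have "lavg U (Suc k) (\<lambda>ys. of_bool (x \<in> set ys) * D ys)
      \<le> pavg U (\<lambda>y. of_bool (y = x) * lavg U k (\<lambda>ys. D (y # ys))
                 + lavg U k (\<lambda>ys. of_bool (x \<in> set ys) * D (y # ys)))"
    unfolding lavg.simps lavg_cmult[symmetric] lavg_add[symmetric]
    using D by (intro pavg_mono lavg_mono) auto
  also have "\<dots> = pavg U (\<lambda>y. of_bool (y = x) * lavg U k (\<lambda>ys. D (y # ys)))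
                 + pavg U (\<lambda>y. lavg U k (\<lambda>ys. of_bool (x \<in> set ys) * D (y # ys)))"
    by (rule pavg_add)
  also have "pavg U (\<lambda>y. of_bool (y = x) * lavg U k (\<lambda>ys. D (y # ys))) = lavg U k (\<lambda>ys. D (x # ys)) / n"
    using x by (simp add: U_def pavg_uniform of_bool_def if_distrib if_distribR sum.delta cong: if_cong)
  finally show ?thesis using x by (simp add: pavg_cmult field_simps)
qed

lemma tuple_hit_prob:
  assumes x: "x < n"
  defines "U \<equiv> pmf_of_set {..<n::nat}"
  shows "n * lavg U k (\<lambda>ys. of_bool (x \<in> set ys)) \<le> k"
proof (induction k)
  case (Suc k)
  have fin: "finite (set_pmf U)" using x by (simp add: U_def finite_set_uniform)
  have "n * lavg U (Suc k) (\<lambda>ys. of_bool (x \<in> set ys)) \<le> 1 + n * lavg U k (\<lambda>ys. of_bool (x \<in> set ys))"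
    using tuple_hit_Suc[OF x, of "\<lambda>_. 1" k, folded U_def] by (simp add: lavg_const pavg_const fin)
  then show ?case using Suc by simp
qed simp

lemma tuple_sum:
  assumes "finite (set_pmf U)"
  shows "lavg U k (\<lambda>ys. \<Sum>y\<leftarrow>ys. e y) = k * pavg U e"
  by (induction k) (simp_all add: lavg_add pavg_add lavg_const pavg_const assms algebra_simps)

text \<open>The condition \<open>e x = 0\<close> is essential: a tuple forced to contain
  \<open>x\<close> always sees \<open>e x\<close>, which an average over all variables does not
  control. The other coordinates remain uniform.\<close>

lemma tuple_hit_sum:
  assumes x: "x < n" and e: "\<And>y. e y \<ge> 0" "e x = 0"
  defines "U \<equiv> pmf_of_set {..<n::nat}"
  shows "n * lavg U k (\<lambda>ys. of_bool (x \<in> set ys) * (\<Sum>y\<leftarrow>ys. e y)) \<le> (real k)\<^sup>2 * pavg U e"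
proof (induction k)
  case (Suc k)
  have fin: "finite (set_pmf U)" using x by (simp add: U_def finite_set_uniform)
  have e0: "pavg U e \<ge> 0" by (intro pavg_nonneg e)
  let ?A = "lavg U k (\<lambda>ys. of_bool (x \<in> set ys))"
  let ?B = "lavg U k (\<lambda>ys. of_bool (x \<in> set ys) * (\<Sum>y\<leftarrow>ys. e y))"
  have "n * lavg U (Suc k) (\<lambda>ys. of_bool (x \<in> set ys) * (\<Sum>y\<leftarrow>ys. e y))
     \<le> lavg U k (\<lambda>ys. \<Sum>y\<leftarrow>x # ys. e y)
       + pavg U (\<lambda>y. n * lavg U k (\<lambda>ys. of_bool (x \<in> set ys) * (\<Sum>y\<leftarrow>y # ys. e y)))"
    unfolding U_def by (rule tuple_hit_Suc[OF x]) (auto intro!: sum_list_nonneg e)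
  also have "\<dots> = k * pavg U e
       + pavg U (\<lambda>y. n * lavg U k (\<lambda>ys. of_bool (x \<in> set ys) * (e y + (\<Sum>y\<leftarrow>ys. e y))))"
    using e by (simp add: tuple_sum[OF fin])
  also have "pavg U (\<lambda>y. n * lavg U k (\<lambda>ys. of_bool (x \<in> set ys) * (e y + (\<Sum>y\<leftarrow>ys. e y))))
      = pavg U (\<lambda>y. (n * ?A) * e y + n * ?B)"
    by (simp add: distrib_left lavg_add lavg_cmult[symmetric] mult_ac)
  also have "\<dots> = (n * ?A) * pavg U e + n * ?B"
    by (simp only: pavg_add pavg_cmult pavg_const[OF fin])
  also have "\<dots> \<le> k * pavg U e + (real k)\<^sup>2 * pavg U e"
    using tuple_hit_prob[OF x, of k] e0 Suc by (intro add_mono mult_right_mono) (auto simp: U_def)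
  finally show ?case using e0 by (simp add: power2_eq_square algebra_simps)
qed simp

lemma lavg_uniform:
  assumes "n > 0"
  shows "lavg (pmf_of_set {..<n}) k h = (\<Sum>ys\<in>{ys. length ys = k \<and> set ys \<subseteq> {..<n}}. h ys) / real n ^ k"
proof (induction k arbitrary: h)
  case (Suc k)
  let ?L = "\<lambda>k. {ys. length ys = k \<and> set ys \<subseteq> {..<n}}"
  have "?L (Suc k) = (\<lambda>(y, ys). y # ys) ` ({..<n} \<times> ?L k)"
    by (auto simp: length_Suc_conv image_iff)
  then have "sum h (?L (Suc k)) = (\<Sum>y<n. \<Sum>ys\<in>?L k. h (y # ys))"
    by (simp add: sum.reindex inj_on_def case_prod_unfold sum.cartesian_product)
  then show ?case using assms
    by (simp add: Suc pavg_uniform sum_divide_distrib mult.commute)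
qed (simp add: if_distrib cong: if_cong conj_cong)

lemma set_random_tuple:
  "n > 0 \<Longrightarrow> set_pmf (random_tuple n k) = {ys. length ys = k \<and> set ys \<subseteq> {..<n}}"
  unfolding random_tuple_def
proof (rule set_pmf_of_set)
  assume "n > 0"
  then have "replicate k 0 \<in> {ys. length ys = k \<and> set ys \<subseteq> {..<n}}" by auto
  then show "{ys. length ys = k \<and> set ys \<subseteq> {..<n}} \<noteq> {}" by blast
  show "finite {ys. length ys = k \<and> set ys \<subseteq> {..<n}}"
    using finite_lists_length_eq[of "{..<n}" k] by (simp add: conj_commute)
qed

lemma pavg_random_tuple:
  assumes "n > 0"
  shows "pavg (random_tuple n k) h = lavg (pmf_of_set {..<n}) k h"
proof -
  let ?L = "{ys. length ys = k \<and> set ys \<subseteq> {..<n}}"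
  have ne: "?L \<noteq> {}" using set_random_tuple[OF assms, of k] by (metis set_pmf_not_empty)
  have fin: "finite ?L" and card: "card ?L = n ^ k"
    using finite_lists_length_eq[of "{..<n}" k] card_lists_length_eq[of "{..<n}" k]
    by (simp_all add: conj_commute)
  have "pmf (random_tuple n k) ys = 1 / real n ^ k" if "ys \<in> ?L" for ys
    unfolding random_tuple_def using that ne fin card by (simp add: pmf_of_set)
  then show ?thesis unfolding pavg_def set_random_tuple[OF assms] lavg_uniform[OF assms]
    by (simp add: sum_divide_distrib)
qed

lemma pavg_pair: "pavg (pair_pmf p q) h = pavg p (\<lambda>a. pavg q (\<lambda>b. h (a, b)))"
  unfolding pavg_def
  by (auto simp: pmf_pair sum_distrib_left sum.cartesian_product mult_ac intro!: sum.cong)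

section \<open>Decorrelation along a random tuple\<close>

context config_measure begin

abbreviation "U \<equiv> pmf_of_set {..<n}"

lemma finite_U: "finite (set_pmf U)" by (rule finite_set_uniform[OF n_pos])

lemma card_spins: "1 \<le> real CARD('o)" using zero_less_card_finite[where ?'a = 'o] by linarith

lemma pspin_bound:
  assumes "\<And>\<sigma>. \<sigma> \<in> configs n \<Longrightarrow> \<bar>F \<sigma>\<bar> \<le> K" "\<sigma> \<in> configs n"
  shows "\<bar>F \<sigma> * pspin x s y t \<sigma>\<bar> \<le> K"
  using assms(1)[OF assms(2)] by (auto simp: pspin_def)

lemma pavg_dev1:
  assumes F: "\<And>\<sigma>. \<sigma> \<in> configs n \<Longrightarrow> \<bar>F \<sigma>\<bar> \<le> K"
  shows "pavg U (dev1 x s F) \<le> CARD('o) * (K * sqrt corr)"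
  using dev1_le[of F K x s] F n_pos by (simp add: pavg_uniform field_simps)

text \<open>Each of the \<open>k\<close> peelings uses the Bessel bound once, and summing over the
  removed spin gives a factor \<open>CARD('o)\<close>. Multiplication by \<open>pspin\<close>
  preserves the bound \<open>K\<close>, which lets the induction run over all
  \<open>F\<close>.\<close>

lemma lavg_dev:
  assumes F: "\<And>\<sigma>. \<sigma> \<in> configs n \<Longrightarrow> \<bar>F \<sigma>\<bar> \<le> K"
  shows "lavg U k (\<lambda>ys. dev x s F (set ys)) \<le> real k * real CARD('o) ^ k * (K * sqrt corr)"
  using F
proof (induction k arbitrary: F)
  case (Suc k)
  let ?q = "real CARD('o)" and ?R = "K * sqrt corr"
  have "K \<ge> 0" by (rule bound_nonneg) (rule Suc.prems)
  then have R: "?R \<ge> 0" using corr_nonneg by simp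
  have "lavg U (Suc k) (\<lambda>ys. dev x s F (set ys))
      \<le> pavg U (\<lambda>y. lavg U k (\<lambda>ys. dev1 x s F y + (\<Sum>t\<in>UNIV. dev x s (\<lambda>\<sigma>. F \<sigma> * pspin x s y t \<sigma>) (set ys))))"
    unfolding lavg.simps by (intro pavg_mono lavg_mono) (simp add: dev_insert)
  also have "\<dots> = pavg U (dev1 x s F)
      + pavg U (\<lambda>y. \<Sum>t\<in>UNIV. lavg U k (\<lambda>ys. dev x s (\<lambda>\<sigma>. F \<sigma> * pspin x s y t \<sigma>) (set ys)))"
    by (simp add: lavg_add lavg_const[OF finite_U] lavg_sum pavg_add)
  also have "\<dots> \<le> ?q * ?R + pavg U (\<lambda>y. \<Sum>t\<in>(UNIV::'o set). k * ?q ^ k * ?R)"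
    using Suc.prems
    by (intro add_mono pavg_dev1 pavg_mono sum_mono Suc.IH pspin_bound) auto
  also have "\<dots> = ?q * ?R + k * ?q ^ Suc k * ?R"
    by (simp add: pavg_const[OF finite_U])
  also have "\<dots> \<le> ?q ^ Suc k * ?R + k * ?q ^ Suc k * ?R"
    using R card_spins by (intro add_mono mult_right_mono order_refl) (auto simp: one_le_power)
  finally show ?case by (simp add: algebra_simps)
qed simp

text \<open>If the first coordinate is \<open>x\<close>, it is pinned and costs no covariance.
  Otherwise its covariance is multiplied by the probability, at most \<open>k / n\<close>, that a
  later coordinate equals \<open>x\<close>.\<close>

lemma lavg_hit_dev:
  assumes x: "x < n" and F: "\<And>\<sigma>. \<sigma> \<in> configs n \<Longrightarrow> \<bar>F \<sigma>\<bar> \<le> K"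
  shows "n * lavg U k (\<lambda>ys. of_bool (x \<in> set ys) * dev x s F (set ys))
       \<le> (real k)\<^sup>2 * real CARD('o) ^ k * (K * sqrt corr)"
  using F
proof (induction k arbitrary: F)
  case (Suc k)
  let ?q = "real CARD('o)" and ?R = "K * sqrt corr"
  let ?G = "\<lambda>y t \<sigma>. F \<sigma> * pspin x s y t \<sigma>"
  let ?A = "lavg U k (\<lambda>ys. of_bool (x \<in> set ys))"
  let ?B = "\<lambda>y t. lavg U k (\<lambda>ys. of_bool (x \<in> set ys) * dev x s (?G y t) (set ys))"
  have "K \<ge> 0" by (rule bound_nonneg) (rule Suc.prems)
  then have R: "?R \<ge> 0" using corr_nonneg by simp
  have 1: "lavg U k (\<lambda>ys. dev x s F (set (x # ys))) \<le> k * ?q ^ Suc k * ?R"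
  proof -
    have "lavg U k (\<lambda>ys. dev x s F (set (x # ys)))
        \<le> lavg U k (\<lambda>ys. \<Sum>t\<in>UNIV. dev x s (?G x t) (set ys))"
      using dev_insert[of "set _" x s F x] by (intro lavg_mono) (simp add: dev1_self)
    also have "\<dots> \<le> (\<Sum>t\<in>(UNIV::'o set). k * ?q ^ k * ?R)"
      unfolding lavg_sum using Suc.prems
      by (intro sum_mono lavg_dev pspin_bound) auto
    finally show ?thesis by (simp add: algebra_simps)
  qed
  have 2: "n * lavg U k (\<lambda>ys. of_bool (x \<in> set ys) * dev x s F (set (y # ys)))
      \<le> (n * ?A) * dev1 x s F y + (\<Sum>t\<in>UNIV. n * ?B y t)" for y
  proof -
    have "lavg U k (\<lambda>ys. of_bool (x \<in> set ys) * dev x s F (set (y # ys)))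
      \<le> lavg U k (\<lambda>ys. dev1 x s F y * of_bool (x \<in> set ys)
           + (\<Sum>t\<in>UNIV. of_bool (x \<in> set ys) * dev x s (?G y t) (set ys)))"
      using dev_insert[of "set _" x s F y]
      by (intro lavg_mono) (auto simp: dev_nonneg dev1_nonneg intro!: add_nonneg_nonneg sum_nonneg)
    also have "\<dots> = ?A * dev1 x s F y + (\<Sum>t\<in>UNIV. ?B y t)"
      unfolding lavg_add lavg_cmult lavg_sum by (simp only: mult.commute)
    finally have "n * lavg U k (\<lambda>ys. of_bool (x \<in> set ys) * dev x s F (set (y # ys)))
      \<le> n * (?A * dev1 x s F y + (\<Sum>t\<in>UNIV. ?B y t))" by (rule mult_left_mono) simp
    then show ?thesis by (simp add: algebra_simps sum_distrib_left)
  qed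
  have "n * lavg U (Suc k) (\<lambda>ys. of_bool (x \<in> set ys) * dev x s F (set ys))
      \<le> k * ?q ^ Suc k * ?R + pavg U (\<lambda>y. (n * ?A) * dev1 x s F y + (\<Sum>t\<in>UNIV. n * ?B y t))"
    by (rule order_trans[OF tuple_hit_Suc[OF x dev_nonneg]]) (intro add_mono 1 pavg_mono 2)
  also have "\<dots> = k * ?q ^ Suc k * ?R + ((n * ?A) * pavg U (dev1 x s F) + pavg U (\<lambda>y. \<Sum>t\<in>UNIV. n * ?B y t))"
    by (simp only: pavg_add pavg_cmult)
  also have "\<dots> \<le> k * ?q ^ Suc k * ?R + (k * (?q * ?R)
      + pavg U (\<lambda>y. \<Sum>t\<in>(UNIV::'o set). (real k)\<^sup>2 * ?q ^ k * ?R))"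
    using Suc.prems
    by (intro add_mono order_refl mult_mono tuple_hit_prob[OF x] pavg_dev1 pavg_mono sum_mono
        Suc.IH pspin_bound pavg_nonneg dev1_nonneg) auto
  also have "\<dots> \<le> k * ?q ^ Suc k * ?R + (k * (?q ^ Suc k * ?R) + (real k)\<^sup>2 * ?q ^ Suc k * ?R)"
    using R card_spins
    by (intro add_mono mult_left_mono mult_right_mono order_refl)
      (auto simp: one_le_power pavg_const[OF finite_U])
  \<comment> \<open>The two terms linear in \<open>k\<close> fit into
    \<open>(k + 1)^2 - k^2\<close>.\<close>
  also have "\<dots> \<le> (real (Suc k))\<^sup>2 * ?q ^ Suc k * ?R"
  proof -
    have "0 \<le> ?q ^ Suc k * ?R" by (rule mult_nonneg_nonneg[OF _ R]) simp
    then show ?thesis by (simp add: power2_eq_square algebra_simps)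
  qed
  finally show ?case by simp
qed simp

end

section \<open>Random constraints attached to a fixed variable\<close>

text \<open>The measure \<open>p\<close> stays abstract here; it becomes the Gibbs measure of the
  constraints away from \<open>x\<close>. The weight bounds straddle 1, so that factors
  \<open>hi\<close> and \<open>1 / lo\<close> can only enlarge an estimate.\<close>

locale bp_setting = config_measure n p for n and p :: "(nat \<Rightarrow> 'o::finite) \<Rightarrow> real" +
  fixes k :: nat and d lo hi :: real and \<rho> :: "'o weight pmf" and x :: nat
  assumes k_pos: "k > 0" and d_pos: "d > 0" and lo: "0 < lo" "lo \<le> 1" and hi: "1 \<le> hi"
    and fin_rho: "finite (set_pmf \<rho>)"
    and weight_bounds: "\<And>\<psi> \<tau>. \<psi> \<in> set_pmf \<rho> \<Longrightarrow> length \<tau> = k \<Longrightarrow> lo \<le> \<psi> \<tau> \<and> \<psi> \<tau> \<le> hi"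
    and x: "x < n"
begin

abbreviation "P \<equiv> pair_pmf \<rho> (random_tuple n k)"
abbreviation "l \<equiv> d * real n / real k"

abbreviation hits :: "'o weight \<times> nat list \<Rightarrow> bool" where
  "hits b \<equiv> x \<in> set (snd b)"

definition g :: "'o \<Rightarrow> 'o weight \<times> nat list \<Rightarrow> (nat \<Rightarrow> 'o) \<Rightarrow> real" where
  "g s b \<sigma> = fst b (map (\<sigma>(x := s)) (snd b))"

lemma in_P: "b \<in> set_pmf P \<longleftrightarrow> fst b \<in> set_pmf \<rho> \<and> length (snd b) = k \<and> set (snd b) \<subseteq> {..<n}"
  by (cases b) (simp add: set_random_tuple[OF n_pos])

lemma weight_bounds_P:
  assumes "b \<in> set_pmf P"
  shows "lo \<le> fst b (map \<tau> (snd b))" "fst b (map \<tau> (snd b)) \<le> hi"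
  using weight_bounds[of "fst b" "map \<tau> (snd b)"] assms unfolding in_P by auto

lemma g_bounds: "b \<in> set_pmf P \<Longrightarrow> lo \<le> g s b \<sigma>" "b \<in> set_pmf P \<Longrightarrow> g s b \<sigma> \<le> hi"
  unfolding g_def by (auto intro: weight_bounds_P)

lemma l_nonneg: "l \<ge> 0" using d_pos by simp

text \<open>The mean \<open>l\<close> supplies the factor \<open>n\<close> carried by the tuple
  estimates, and its denominator removes one factor \<open>k\<close> from them.\<close>

lemma pavg_P_tuple:
  fixes C :: real
  assumes "n * lavg U k h \<le> k * C"
  shows "l * pavg P (\<lambda>b. h (snd b)) \<le> d * C"
proof -
  have "l * pavg P (\<lambda>b. h (snd b)) = d / k * (n * lavg U k h)"
    by (simp add: pavg_pair pavg_random_tuple[OF n_pos] pavg_const[OF fin_rho])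
  also have "\<dots> \<le> d / k * (k * C)" using d_pos assms by (intro mult_left_mono) auto
  finally show ?thesis using k_pos by simp
qed

lemma hit_prob: "l * pavg P (\<lambda>b. of_bool (hits b)) \<le> d"
  using pavg_P_tuple[of "\<lambda>ys. of_bool (x \<in> set ys)" 1] tuple_hit_prob[OF x] by simp

lemma hit_dev:
  assumes F: "\<And>\<sigma>. \<sigma> \<in> configs n \<Longrightarrow> \<bar>F \<sigma>\<bar> \<le> K"
  shows "l * pavg P (\<lambda>b. of_bool (hits b) * dev x s F (set (snd b))) \<le> d * (k * real CARD('o) ^ k * (K * sqrt corr))"
proof (rule pavg_P_tuple[of "\<lambda>ys. of_bool (x \<in> set ys) * dev x s F (set ys)"])
  have "n * lavg U k (\<lambda>ys. of_bool (x \<in> set ys) * dev x s F (set ys))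
      \<le> (real k)\<^sup>2 * real CARD('o) ^ k * (K * sqrt corr)"
    by (rule lavg_hit_dev[OF x]) (rule F)
  then show "n * lavg U k (\<lambda>ys. of_bool (x \<in> set ys) * dev x s F (set ys))
      \<le> k * (k * real CARD('o) ^ k * (K * sqrt corr))"
    by (simp add: power2_eq_square mult_ac)
qed

lemma hit_sum:
  assumes "\<And>y. e y \<ge> 0" "e x = 0"
  shows "l * pavg P (\<lambda>b. of_bool (hits b) * (\<Sum>y\<leftarrow>snd b. e y)) \<le> d * (k * pavg U e)"
  using tuple_hit_sum[where e = e and k = k, OF x assms]
  by (intro pavg_P_tuple[of "\<lambda>ys. of_bool (x \<in> set ys) * (\<Sum>y\<leftarrow>ys. e y)"])
    (simp add: power2_eq_square mult_ac)

text \<open>Expanding the weight into indicators of local assignments makes it accessible to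
  \<open>dev\<close>.\<close>

lemma g_expand:
  assumes "b \<in> set_pmf P"
  shows "g s b \<sigma> = (\<Sum>\<tau>\<in>PiE (set (snd b)) (\<lambda>_. UNIV).
     fst b (map \<tau> (snd b)) * of_bool (\<forall>y\<in>set (snd b). (\<sigma>(x := s)) y = \<tau> y))"
proof -
  let ?Y = "set (snd b)" and ?r = "restrict (\<sigma>(x := s)) (set (snd b))"
  have "(\<Sum>\<tau>\<in>PiE ?Y (\<lambda>_. UNIV). fst b (map \<tau> (snd b)) * of_bool (\<forall>y\<in>?Y. (\<sigma>(x := s)) y = \<tau> y))
      = (\<Sum>\<tau>\<in>PiE ?Y (\<lambda>_. UNIV). if \<tau> = ?r then fst b (map \<tau> (snd b)) else 0)"
  proof (intro sum.cong refl)
    fix \<tau> :: "nat \<Rightarrow> 'o" assume "\<tau> \<in> PiE ?Y (\<lambda>_. UNIV)"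
    then have "(\<forall>y\<in>?Y. (\<sigma>(x := s)) y = \<tau> y) \<longleftrightarrow> \<tau> = ?r"
      by (metis PiE_restrict restrict_apply' restrict_ext)
    then show "fst b (map \<tau> (snd b)) * of_bool (\<forall>y\<in>?Y. (\<sigma>(x := s)) y = \<tau> y)
      = (if \<tau> = ?r then fst b (map \<tau> (snd b)) else 0)" by simp
  qed
  also have "\<dots> = fst b (map ?r (snd b))"
    by (subst sum.delta) (auto intro!: finite_PiE)
  also have "map ?r (snd b) = map (\<sigma>(x := s)) (snd b)" by simp
  finally show ?thesis by (simp add: g_def)
qed

text \<open>The mean of the pinned weight if the spins at its variables were independent with
  unchanged marginals. Both the true expectation and the Belief Propagation formula are compared
  with it.\<close>

definition gbar :: "'o \<Rightarrow> 'o weight \<times> nat list \<Rightarrow> real" where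
  "gbar s b = (\<Sum>\<tau>\<in>PiE (set (snd b)) (\<lambda>_. UNIV).
     fst b (map \<tau> (snd b)) * (\<Prod>y\<in>set (snd b). ex (pspin x s y (\<tau> y))))"

lemma ex_g_gbar:
  assumes b: "b \<in> set_pmf P"
  shows "\<bar>ex (\<lambda>\<sigma>. F \<sigma> * g s b \<sigma>) - ex F * gbar s b\<bar> \<le> hi * dev x s F (set (snd b))"
proof -
  let ?Y = "set (snd b)"
  let ?w = "\<lambda>\<tau>. fst b (map \<tau> (snd b))"
  let ?A = "\<lambda>\<tau>. ex (\<lambda>\<sigma>. F \<sigma> * of_bool (\<forall>y\<in>?Y. (\<sigma>(x := s)) y = \<tau> y))"
  let ?B = "\<lambda>\<tau>. \<Prod>y\<in>?Y. ex (pspin x s y (\<tau> y))"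
  have "ex (\<lambda>\<sigma>. F \<sigma> * g s b \<sigma>) = (\<Sum>\<tau>\<in>PiE ?Y (\<lambda>_. UNIV). ?w \<tau> * ?A \<tau>)"
    unfolding g_expand[OF b] sum_distrib_left ex_sum mult.left_commute[of "F _"] ex_cmult ..
  moreover have "ex F * gbar s b = (\<Sum>\<tau>\<in>PiE ?Y (\<lambda>_. UNIV). ?w \<tau> * (ex F * ?B \<tau>))"
    unfolding gbar_def sum_distrib_left by (simp only: mult.left_commute)
  ultimately have "\<bar>ex (\<lambda>\<sigma>. F \<sigma> * g s b \<sigma>) - ex F * gbar s b\<bar>
      = \<bar>\<Sum>\<tau>\<in>PiE ?Y (\<lambda>_. UNIV). ?w \<tau> * (?A \<tau> - ex F * ?B \<tau>)\<bar>"
    by (simp only: sum_subtractf right_diff_distrib)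
  also have "\<dots> \<le> (\<Sum>\<tau>\<in>PiE ?Y (\<lambda>_. UNIV). \<bar>?w \<tau> * (?A \<tau> - ex F * ?B \<tau>)\<bar>)" by (rule sum_abs)
  also have "\<dots> \<le> (\<Sum>\<tau>\<in>PiE ?Y (\<lambda>_. UNIV). hi * \<bar>?A \<tau> - ex F * ?B \<tau>\<bar>)"
  proof (intro sum_mono)
    fix \<tau>
    show "\<bar>?w \<tau> * (?A \<tau> - ex F * ?B \<tau>)\<bar> \<le> hi * \<bar>?A \<tau> - ex F * ?B \<tau>\<bar>"
      unfolding abs_mult using weight_bounds_P[OF b, of \<tau>] lo by (intro mult_right_mono) auto
  qed
  finally show ?thesis by (simp add: dev_def sum_distrib_left)
qed

lemma ex_g_gbar1:
  assumes "b \<in> set_pmf P"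
  shows "\<bar>ex (g s b) - gbar s b\<bar> \<le> hi * dev x s (\<lambda>_. 1) (set (snd b))"
  using ex_g_gbar[OF assms, of "\<lambda>_. 1" s] by (simp add: ex_const)

text \<open>Both terms of the covariance are close to \<open>ex F * gbar s b\<close>, the second by
  the case of a constant observable.\<close>

lemma cov_g:
  assumes b: "b \<in> set_pmf P" and F: "\<And>\<sigma>. \<sigma> \<in> configs n \<Longrightarrow> \<bar>F \<sigma>\<bar> \<le> K"
  shows "\<bar>cov F (g s b)\<bar> \<le> hi * dev x s F (set (snd b)) + K * (hi * dev x s (\<lambda>_. 1) (set (snd b)))"
proof -
  have K: "K \<ge> 0" by (rule bound_nonneg) (rule F)
  have "\<bar>cov F (g s b)\<bar> \<le> \<bar>ex (\<lambda>\<sigma>. F \<sigma> * g s b \<sigma>) - ex F * gbar s b\<bar> + \<bar>ex F * (ex (g s b) - gbar s b)\<bar>"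
    unfolding cov_def by (simp add: algebra_simps)
  also have "\<dots> \<le> hi * dev x s F (set (snd b)) + K * (hi * dev x s (\<lambda>_. 1) (set (snd b)))"
    unfolding abs_mult using F K
    by (intro add_mono ex_g_gbar[OF b] mult_mono abs_ex_le ex_g_gbar1[OF b]) auto
  finally show ?thesis .
qed

lemma hit_cov:
  assumes F: "\<And>\<sigma>. \<sigma> \<in> configs n \<Longrightarrow> \<bar>F \<sigma>\<bar> \<le> K"
  shows "l * pavg P (\<lambda>b. of_bool (hits b) * \<bar>cov F (g s b)\<bar>) \<le> 2 * hi * d * k * real CARD('o) ^ k * (K * sqrt corr)"
proof -
  let ?D = "\<lambda>F. pavg P (\<lambda>b. of_bool (hits b) * dev x s F (set (snd b)))"
  have K: "K \<ge> 0" by (rule bound_nonneg) (rule F)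
  have "pavg P (\<lambda>b. of_bool (hits b) * \<bar>cov F (g s b)\<bar>)
      \<le> pavg P (\<lambda>b. hi * (of_bool (hits b) * dev x s F (set (snd b)))
          + K * hi * (of_bool (hits b) * dev x s (\<lambda>_. 1) (set (snd b))))"
    using cov_g[of _ F K s] F by (intro pavg_mono) (auto simp: mult_ac)
  also have "\<dots> = hi * ?D F + K * hi * ?D (\<lambda>_. 1)" unfolding pavg_add pavg_cmult ..
  finally have "l * pavg P (\<lambda>b. of_bool (hits b) * \<bar>cov F (g s b)\<bar>) \<le> l * (hi * ?D F + K * hi * ?D (\<lambda>_. 1))"
    by (rule mult_left_mono) (rule l_nonneg)
  also have "\<dots> = hi * (l * ?D F) + K * hi * (l * ?D (\<lambda>_. 1))" by (simp add: algebra_simps)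
  also have "\<dots> \<le> hi * (d * (k * real CARD('o) ^ k * (K * sqrt corr))) + K * hi * (d * (k * real CARD('o) ^ k * (1 * sqrt corr)))"
    using hi K F by (intro add_mono mult_left_mono hit_dev) auto
  finally show ?thesis by (simp add: algebra_simps)
qed

section \<open>Several constraints attached at once\<close>

definition devl :: "'o \<Rightarrow> ((nat \<Rightarrow> 'o) \<Rightarrow> real) \<Rightarrow> ('o weight \<times> nat list) list \<Rightarrow> real" where
  "devl s F c = \<bar>ex (\<lambda>\<sigma>. F \<sigma> * (\<Prod>b\<leftarrow>c. g s b \<sigma>)) - ex F * (\<Prod>b\<leftarrow>c. ex (g s b))\<bar>"

lemma ex_g_bounds:
  assumes "b \<in> set_pmf P"
  shows "lo \<le> ex (g s b)" "ex (g s b) \<le> hi"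
  using ex_bounds[of lo "g s b" hi] g_bounds[OF assms] by auto

lemma prod_list_bounds:
  fixes f :: "'b \<Rightarrow> real"
  assumes "\<And>b. b \<in> set c \<Longrightarrow> lo \<le> f b \<and> f b \<le> hi"
  shows "lo ^ length c \<le> (\<Prod>b\<leftarrow>c. f b) \<and> (\<Prod>b\<leftarrow>c. f b) \<le> hi ^ length c"
  using assms
proof (induction c)
  case (Cons b c)
  have "lo \<le> f b" "f b \<le> hi" using Cons.prems[of b] by auto
  moreover have IH: "lo ^ length c \<le> (\<Prod>b\<leftarrow>c. f b)" "(\<Prod>b\<leftarrow>c. f b) \<le> hi ^ length c"
    using Cons by auto
  moreover have "0 \<le> lo ^ length c" using lo by simp
  ultimately show ?case using lo hi by (auto intro!: mult_mono order_trans[OF _ IH(1)])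
qed simp

text \<open>Peeling again, now by constraints: the removed weight is absorbed into the observable at
  the price of one covariance, times the trivial bound on the remaining product.\<close>

lemma devl_Cons:
  assumes b: "b \<in> set_pmf P" and c: "set c \<subseteq> set_pmf P"
  shows "devl s F (b # c) \<le> devl s (\<lambda>\<sigma>. F \<sigma> * g s b \<sigma>) c + \<bar>cov F (g s b)\<bar> * hi ^ length c"
proof -
  let ?X = "\<Prod>b\<leftarrow>c. ex (g s b)"
  have "lo ^ length c \<le> ?X \<and> ?X \<le> hi ^ length c"
    using ex_g_bounds[of _ s] c by (intro prod_list_bounds) auto
  moreover have "0 \<le> lo ^ length c" using lo by simp
  ultimately have X: "\<bar>?X\<bar> \<le> hi ^ length c" by linarith
  have "devl s F (b # c) \<le> devl s (\<lambda>\<sigma>. F \<sigma> * g s b \<sigma>) c + \<bar>cov F (g s b) * ?X\<bar>"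
    unfolding devl_def cov_def by (simp add: algebra_simps)
  also have "\<dots> \<le> devl s (\<lambda>\<sigma>. F \<sigma> * g s b \<sigma>) c + \<bar>cov F (g s b)\<bar> * hi ^ length c"
    unfolding abs_mult by (intro add_left_mono mult_left_mono X) auto
  finally show ?thesis .
qed

lemma hit_all_prob: "l ^ r * lavg P r (\<lambda>c. of_bool (\<forall>b\<in>set c. hits b)) \<le> d ^ r"
proof (induction r)
  case (Suc r)
  let ?A = "lavg P r (\<lambda>c. of_bool (\<forall>b\<in>set c. hits b))"
  have A0: "?A \<ge> 0" by (intro lavg_nonneg) simp
  have "lavg P (Suc r) (\<lambda>c. of_bool (\<forall>b\<in>set c. hits b)) = ?A * pavg P (\<lambda>b. of_bool (hits b))"
    unfolding lavg.simps pavg_cmult[symmetric] by (simp add: of_bool_conj lavg_cmult mult.commute)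
  then have "l ^ Suc r * lavg P (Suc r) (\<lambda>c. of_bool (\<forall>b\<in>set c. hits b))
      = (l * pavg P (\<lambda>b. of_bool (hits b))) * (l ^ r * ?A)" by (simp add: mult_ac)
  also have "\<dots> \<le> d * d ^ r"
    using d_pos l_nonneg A0 by (intro mult_mono hit_prob Suc) auto
  finally show ?case by simp
qed simp

text \<open>The cost per attached constraint: \<open>d * hi\<close> pays for touching
  \<open>x\<close> and for the growth of the observable, the last summand is the constant of
  \<open>hit_cov\<close>, and 1 makes the powers of \<open>M\<close> increase.\<close>

definition M :: real where "M = 1 + d * hi + 2 * hi * d * k * real CARD('o) ^ k"

lemma M_bounds: "1 \<le> M" "d \<le> M" "d * hi \<le> M" "2 * hi * d * k * real CARD('o) ^ k \<le> M"
proof -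
  have "0 \<le> d * hi" "0 \<le> 2 * hi * d * k * real CARD('o) ^ k" using d_pos hi by simp_all
  moreover have "d \<le> d * hi" using d_pos hi by simp
  ultimately show "1 \<le> M" "d \<le> M" "d * hi \<le> M" "2 * hi * d * k * real CARD('o) ^ k \<le> M"
    unfolding M_def by linarith+
qed

text \<open>Removing a constraint turns \<open>F\<close> into \<open>F * g s b\<close> and
  \<open>K\<close> into \<open>K * hi\<close>, so the induction must vary both. Each of the
  \<open>r\<close> removals adds a covariance term of at most
  \<open>K * M ^ r * sqrt corr\<close>.\<close>

lemma hit_devl:
  assumes F: "\<And>\<sigma>. \<sigma> \<in> configs n \<Longrightarrow> \<bar>F \<sigma>\<bar> \<le> K"
  shows "l ^ r * lavg P r (\<lambda>c. of_bool (\<forall>b\<in>set c. hits b) * devl s F c) \<le> r * K * M ^ r * sqrt corr"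
  using F
proof (induction r arbitrary: F K)
  case 0
  show ?case by (simp add: devl_def)
next
  case (Suc r)
  let ?R = "sqrt corr"
  let ?I = "\<lambda>c. of_bool (\<forall>b\<in>set c. hits b) :: real"
  let ?G = "\<lambda>b \<sigma>. F \<sigma> * g s b \<sigma>"
  let ?A = "lavg P r ?I"
  have K: "K \<ge> 0" by (rule bound_nonneg) (rule Suc.prems)
  have R: "?R \<ge> 0" using corr_nonneg by simp
  have M0: "M ^ r \<ge> 0" using M_bounds by simp
  have A0: "?A \<ge> 0" by (intro lavg_nonneg) simp
  have IH: "l ^ r * lavg P r (\<lambda>c. ?I c * devl s (?G b) c) \<le> r * (K * hi) * M ^ r * ?R"
    if "b \<in> set_pmf P" for b
  proof (rule Suc.IH)
    fix \<sigma> :: "nat \<Rightarrow> 'o" assume "\<sigma> \<in> configs n"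
    then show "\<bar>F \<sigma> * g s b \<sigma>\<bar> \<le> K * hi"
      unfolding abs_mult using g_bounds[OF that, of s \<sigma>] lo K by (intro mult_mono Suc.prems) auto
  qed
  have hd: "hi ^ r * (l ^ r * ?A) \<le> M ^ r"
  proof -
    have "hi ^ r * (l ^ r * ?A) \<le> hi ^ r * d ^ r"
      using hi by (intro mult_left_mono hit_all_prob) auto
    also have "\<dots> = (d * hi) ^ r" by (simp add: power_mult_distrib)
    also have "\<dots> \<le> M ^ r" using M_bounds d_pos hi by (intro power_mono) auto
    finally show ?thesis .
  qed
  have "lavg P (Suc r) (\<lambda>c. ?I c * devl s F c)
      \<le> pavg P (\<lambda>b. of_bool (hits b) * lavg P r (\<lambda>c. ?I c * devl s (?G b) c + (\<bar>cov F (g s b)\<bar> * hi ^ r) * ?I c))"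
    unfolding lavg.simps lavg_cmult[symmetric]
    using devl_Cons[of _ _ s F] by (intro pavg_mono lavg_mono) auto
  also have "\<dots> = pavg P (\<lambda>b. of_bool (hits b) * (lavg P r (\<lambda>c. ?I c * devl s (?G b) c) + \<bar>cov F (g s b)\<bar> * hi ^ r * ?A))"
    unfolding lavg_add lavg_cmult ..
  finally have "l ^ Suc r * lavg P (Suc r) (\<lambda>c. ?I c * devl s F c)
      \<le> l ^ Suc r * \<dots>" by (rule mult_left_mono) (rule zero_le_power[OF l_nonneg])
  also have "\<dots> = l * pavg P (\<lambda>b. of_bool (hits b) *
       (l ^ r * lavg P r (\<lambda>c. ?I c * devl s (?G b) c) + \<bar>cov F (g s b)\<bar> * (hi ^ r * (l ^ r * ?A))))"
  proof -
    have "pavg P (\<lambda>b. of_bool (hits b) *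
       (l ^ r * lavg P r (\<lambda>c. ?I c * devl s (?G b) c) + \<bar>cov F (g s b)\<bar> * (hi ^ r * (l ^ r * ?A))))
      = pavg P (\<lambda>b. l ^ r * (of_bool (hits b) *
       (lavg P r (\<lambda>c. ?I c * devl s (?G b) c) + \<bar>cov F (g s b)\<bar> * hi ^ r * ?A)))"
      by (rule pavg_cong) (simp only: algebra_simps)
    then show ?thesis unfolding pavg_cmult by (simp only: power_Suc mult.assoc)
  qed
  also have "\<dots> \<le> l * pavg P (\<lambda>b. of_bool (hits b) * (r * (K * hi) * M ^ r * ?R + \<bar>cov F (g s b)\<bar> * M ^ r))"
    by (intro mult_left_mono pavg_mono add_mono IH hd l_nonneg) auto
  also have "\<dots> = (r * (K * hi) * M ^ r * ?R) * (l * pavg P (\<lambda>b. of_bool (hits b)))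
      + M ^ r * (l * pavg P (\<lambda>b. of_bool (hits b) * \<bar>cov F (g s b)\<bar>))"
  proof -
    have "pavg P (\<lambda>b. of_bool (hits b) * (r * (K * hi) * M ^ r * ?R + \<bar>cov F (g s b)\<bar> * M ^ r))
        = pavg P (\<lambda>b. (r * (K * hi) * M ^ r * ?R) * of_bool (hits b) + M ^ r * (of_bool (hits b) * \<bar>cov F (g s b)\<bar>))"
      by (intro pavg_cong) (simp add: algebra_simps)
    then show ?thesis unfolding pavg_add pavg_cmult by (simp add: algebra_simps)
  qed
  also have "\<dots> \<le> (r * (K * hi) * M ^ r * ?R) * d + M ^ r * (2 * hi * d * k * real CARD('o) ^ k * (K * ?R))"
    using K R M0 hi Suc.prems by (intro add_mono mult_left_mono hit_prob hit_cov) auto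
  also have "\<dots> = (d * hi) * (r * K * M ^ r * ?R) + (2 * hi * d * k * real CARD('o) ^ k) * (K * M ^ r * ?R)"
    by (simp add: algebra_simps)
  also have "\<dots> \<le> M * (r * K * M ^ r * ?R) + M * (K * M ^ r * ?R)"
    using K R M0 M_bounds by (intro add_mono mult_right_mono) auto
  finally show ?case by (simp add: algebra_simps)
qed

end

section \<open>The Belief Propagation equations at an isolated variable\<close>

text \<open>The contribution of the pair \<open>(x, b)\<close> to the Belief Propagation error, where \<open>c\<close> lists the other
  constraints at \<open>x\<close> and \<open>G\<close> the constraints away from \<open>x\<close>.\<close>

definition local_err :: "nat \<Rightarrow> nat \<Rightarrow> 'o::finite weight \<times> nat list \<Rightarrow> 'o fgraph \<Rightarrow> 'o fgraph \<Rightarrow> real" where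
  "local_err n x b c G = (\<Sum>s\<in>UNIV.
       \<bar>marg n (c @ G) x s
         - (\<Prod>b'\<leftarrow>c. marg n (b' # G) x s) / (\<Sum>t\<in>UNIV. \<Prod>b'\<leftarrow>c. marg n (b' # G) x t)\<bar>
     + \<bar>marg n (b # G) x s
         - (\<Sum>\<tau>\<in>PiE (set (snd b)) (\<lambda>_. UNIV).
              (if \<tau> x = s then fst b (map \<tau> (snd b)) *
                 (\<Prod>y\<in>set (snd b) - {x}. marg n (c @ G) y (\<tau> y)) else 0))
           / (\<Sum>\<tau>\<in>PiE (set (snd b)) (\<lambda>_. UNIV).
               fst b (map \<tau> (snd b)) *
                 (\<Prod>y\<in>set (snd b) - {x}. marg n (c @ G) y (\<tau> y)))\<bar>)"

lemma local_err_nonneg: "local_err n x b c G \<ge> 0"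
  unfolding local_err_def by (intro sum_nonneg) auto

text \<open>The normalisers differ by at most the L1 distance, and the normalised \<open>B\<close>
  has mass one; this accounts for the factor 2. Both error terms are divided by
  \<open>sum A S\<close>, so its lower bound \<open>L\<close> governs the estimate.\<close>

lemma sum_normalize_diff_le:
  fixes A B :: "'a \<Rightarrow> real"
  assumes L: "0 < L" "L \<le> sum A S" and B: "\<And>s. s \<in> S \<Longrightarrow> B s \<ge> 0" "sum B S > 0"
  shows "(\<Sum>s\<in>S. \<bar>A s / sum A S - B s / sum B S\<bar>) \<le> 2 / L * (\<Sum>s\<in>S. \<bar>A s - B s\<bar>)"
proof -
  let ?a = "sum A S" and ?b = "sum B S"
  have a: "?a > 0" using L by linarith
  have "\<bar>A s / ?a - B s / ?b\<bar> \<le> \<bar>A s - B s\<bar> / ?a + B s / ?b * (\<bar>?a - ?b\<bar> / ?a)" if "s \<in> S" for s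
  proof -
    have "A s / ?a - B s / ?b = (A s - B s) / ?a + B s / ?b * ((?b - ?a) / ?a)"
      using a B(2) by (simp add: field_simps)
    also have "\<bar>\<dots>\<bar> \<le> \<bar>(A s - B s) / ?a\<bar> + \<bar>B s / ?b * ((?b - ?a) / ?a)\<bar>" by (rule abs_triangle_ineq)
    also have "\<dots> = \<bar>A s - B s\<bar> / ?a + B s / ?b * (\<bar>?a - ?b\<bar> / ?a)"
      using a B that by (simp add: abs_mult abs_minus_commute)
    finally show ?thesis .
  qed
  then have "(\<Sum>s\<in>S. \<bar>A s / ?a - B s / ?b\<bar>) \<le> (\<Sum>s\<in>S. \<bar>A s - B s\<bar> / ?a + B s / ?b * (\<bar>?a - ?b\<bar> / ?a))"
    by (intro sum_mono)
  also have "\<dots> = (\<Sum>s\<in>S. \<bar>A s - B s\<bar>) / ?a + \<bar>?a - ?b\<bar> / ?a"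
    using B(2) by (simp add: sum.distrib sum_divide_distrib[symmetric] sum_distrib_right[symmetric])
  also have "\<dots> \<le> (\<Sum>s\<in>S. \<bar>A s - B s\<bar>) / ?a + (\<Sum>s\<in>S. \<bar>A s - B s\<bar>) / ?a"
    using a by (intro add_left_mono divide_right_mono) (auto simp: sum_subtractf[symmetric])
  also have "\<dots> = 2 * (\<Sum>s\<in>S. \<bar>A s - B s\<bar>) / ?a" by simp
  also have "\<dots> \<le> 2 * (\<Sum>s\<in>S. \<bar>A s - B s\<bar>) / L"
    using L a by (intro divide_left_mono mult_pos_pos) (auto intro: sum_nonneg)
  finally show ?thesis by simp
qed

text \<open>Exchanging one factor at a time costs the L1 distance of that factor, because the other
  factors have mass one.\<close>

lemma sum_prod_diff_le:
  fixes u v :: "'a \<Rightarrow> 'o::finite \<Rightarrow> real"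
  assumes "finite Y"
    and "\<And>y t. u y t \<ge> 0" "\<And>y. (\<Sum>t\<in>UNIV. u y t) = 1"
    and "\<And>y t. v y t \<ge> 0" "\<And>y. (\<Sum>t\<in>UNIV. v y t) = 1"
  shows "(\<Sum>\<tau>\<in>PiE Y (\<lambda>_. UNIV). \<bar>(\<Prod>y\<in>Y. u y (\<tau> y)) - (\<Prod>y\<in>Y. v y (\<tau> y))\<bar>)
    \<le> (\<Sum>y\<in>Y. \<Sum>t\<in>UNIV. \<bar>u y t - v y t\<bar>)"
  using assms(1)
proof (induction Y)
  case (insert z Y)
  let ?U = "\<lambda>\<tau>. \<Prod>y\<in>Y. u y (\<tau> y)" and ?V = "\<lambda>\<tau>. \<Prod>y\<in>Y. v y (\<tau> y)"
  let ?E = "PiE Y (\<lambda>_. UNIV :: 'o set)"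
  have one: "sum ?U ?E = 1"
    using prod_sum_PiE[of Y "\<lambda>_. UNIV" u] insert(1) assms(3) by simp
  have upd: "(\<Prod>y\<in>insert z Y. w y ((\<tau>(z := t)) y)) = w z t * (\<Prod>y\<in>Y. w y (\<tau> y))"
    for w :: "'a \<Rightarrow> 'o \<Rightarrow> real" and \<tau> t
    using insert by (subst prod.insert) (auto intro!: prod.cong)
  have "(\<Sum>\<tau>\<in>PiE (insert z Y) (\<lambda>_. UNIV). \<bar>(\<Prod>y\<in>insert z Y. u y (\<tau> y)) - (\<Prod>y\<in>insert z Y. v y (\<tau> y))\<bar>)
      = (\<Sum>t\<in>UNIV. \<Sum>\<tau>\<in>?E. \<bar>u z t * ?U \<tau> - v z t * ?V \<tau>\<bar>)"
    unfolding sum_PiE_insert[OF insert(2)] upd ..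
  also have "\<dots> \<le> (\<Sum>t\<in>UNIV. \<Sum>\<tau>\<in>?E. \<bar>u z t - v z t\<bar> * ?U \<tau> + v z t * \<bar>?U \<tau> - ?V \<tau>\<bar>)"
  proof (intro sum_mono)
    fix t \<tau>
    have "u z t * ?U \<tau> - v z t * ?V \<tau> = (u z t - v z t) * ?U \<tau> + v z t * (?U \<tau> - ?V \<tau>)"
      by (simp add: algebra_simps)
    also have "\<bar>\<dots>\<bar> \<le> \<bar>(u z t - v z t) * ?U \<tau>\<bar> + \<bar>v z t * (?U \<tau> - ?V \<tau>)\<bar>" by (rule abs_triangle_ineq)
    also have "\<dots> = \<bar>u z t - v z t\<bar> * ?U \<tau> + v z t * \<bar>?U \<tau> - ?V \<tau>\<bar>"
      using assms by (simp add: abs_mult prod_nonneg)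
    finally show "\<bar>u z t * ?U \<tau> - v z t * ?V \<tau>\<bar> \<le> \<bar>u z t - v z t\<bar> * ?U \<tau> + v z t * \<bar>?U \<tau> - ?V \<tau>\<bar>" .
  qed
  also have "\<dots> = (\<Sum>t\<in>UNIV. \<bar>u z t - v z t\<bar>) + (\<Sum>\<tau>\<in>?E. \<bar>?U \<tau> - ?V \<tau>\<bar>)"
    unfolding sum.distrib sum_distrib_left[symmetric] one by (simp add: sum_distrib_right[symmetric] assms)
  also have "\<dots> \<le> (\<Sum>t\<in>UNIV. \<bar>u z t - v z t\<bar>) + (\<Sum>y\<in>Y. \<Sum>t\<in>UNIV. \<bar>u y t - v y t\<bar>)"
    using insert by simp
  finally show ?case using insert by simp
qed simp

lemma sum_set_le_sum_list:
  fixes f :: "'a \<Rightarrow> real"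
  assumes "\<And>y. f y \<ge> 0"
  shows "(\<Sum>y\<in>set ys. f y) \<le> (\<Sum>y\<leftarrow>ys. f y)"
proof (induction ys)
  case (Cons y ys)
  then show ?case using assms[of y] by (cases "y \<in> set ys") (auto simp: insert_absorb)
qed simp

lemma prod_list_divide:
  fixes f h :: "'a \<Rightarrow> real"
  shows "(\<Prod>b\<leftarrow>c. f b / h b) = (\<Prod>b\<leftarrow>c. f b) / (\<Prod>b\<leftarrow>c. h b)"
  by (induction c) auto

lemma prod_list_pos:
  fixes f :: "'a \<Rightarrow> real"
  shows "(\<And>b. b \<in> set c \<Longrightarrow> f b > 0) \<Longrightarrow> (\<Prod>b\<leftarrow>c. f b) > 0"
  by (induction c) auto

locale gibbs_setting = bp_setting n "gibbs n G" k d lo hi \<rho> x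
  for n and G :: "'o::finite fgraph" and k d lo hi \<rho> x +
  assumes G_sub: "set G \<subseteq> set_pmf P" and G_miss: "\<forall>b\<in>set G. \<not> hits b"
begin

lemma weight_of_bounds:
  assumes "set c \<subseteq> set_pmf P"
  shows "lo ^ length c \<le> weight_of c \<sigma>" "weight_of c \<sigma> \<le> hi ^ length c"
proof -
  have "lo ^ length c \<le> (\<Prod>b\<leftarrow>c. fst b (map \<sigma> (snd b))) \<and> (\<Prod>b\<leftarrow>c. fst b (map \<sigma> (snd b))) \<le> hi ^ length c"
    using weight_bounds_P assms by (intro prod_list_bounds) blast
  then show "lo ^ length c \<le> weight_of c \<sigma>" "weight_of c \<sigma> \<le> hi ^ length c"
    by (simp_all add: weight_of_def case_prod_unfold)
qed

lemma lo_power_pos: "lo ^ r > 0" using lo by simp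

lemma partition_pos: "partition_fun n G > 0"
proof -
  have "configs n \<noteq> ({} :: (nat \<Rightarrow> 'o) set)" using p_sum by auto
  then show ?thesis unfolding partition_fun_def
    using weight_of_bounds(1)[OF G_sub] lo_power_pos finite_configs
    by (intro sum_pos) (auto intro: less_le_trans)
qed

lemma ex_weight_bounds:
  assumes "set c \<subseteq> set_pmf P"
  shows "lo ^ length c \<le> ex (weight_of c)"
  using weight_of_bounds[OF assms] by (intro ex_bounds(1)) auto

text \<open>Attaching constraints reweights the Gibbs measure of \<open>G\<close>. All messages thus
  become ratios of expectations under one fixed measure.\<close>

lemma marg_append:
  "marg n (c @ G) y t = ex (\<lambda>\<sigma>. weight_of c \<sigma> * spin y t \<sigma>) / ex (weight_of c)"
proof -
  have w: "weight_of (c @ G) \<sigma> = weight_of c \<sigma> * weight_of G \<sigma>" for \<sigma>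
    by (simp add: weight_of_def)
  have e: "ex f = (\<Sum>\<sigma>\<in>configs n. weight_of G \<sigma> * f \<sigma>) / partition_fun n G" for f
    by (simp add: ex_def gibbs_def sum_divide_distrib)
  have "marg n (c @ G) y t = (\<Sum>\<sigma>\<in>configs n. weight_of G \<sigma> * (weight_of c \<sigma> * spin y t \<sigma>)) / partition_fun n (c @ G)"
    unfolding marg_def gibbs_def sum_divide_distrib w by (intro sum.cong) (auto simp: spin_def)
  also have "partition_fun n (c @ G) = (\<Sum>\<sigma>\<in>configs n. weight_of G \<sigma> * weight_of c \<sigma>)"
    unfolding partition_fun_def w by (simp add: mult.commute)
  finally show ?thesis using partition_pos by (simp add: e)
qed

lemma gibbs_upd: "gibbs n G (\<sigma>(x := t)) = gibbs n G \<sigma>"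
proof -
  have *: "map (\<sigma>(x := t)) (snd b) = map \<sigma> (snd b)" if "b \<in> set G" for b
    using G_miss that by auto
  have "map (\<lambda>(\<psi>, ys). \<psi> (map (\<sigma>(x := t)) ys)) G = map (\<lambda>(\<psi>, ys). \<psi> (map \<sigma> ys)) G"
    unfolding case_prod_unfold by (intro map_cong refl) (simp only: *)
  then have "weight_of G (\<sigma>(x := t)) = weight_of G \<sigma>"
    unfolding weight_of_def by (rule arg_cong)
  then show ?thesis by (simp add: gibbs_def)
qed

text \<open>No constraint of \<open>G\<close> touches \<open>x\<close>, so its spin is uniform and
  independent of the others. Selecting \<open>s\<close> at \<open>x\<close> therefore amounts to
  pinning, up to a constant that cancels in all ratios.\<close>

lemma ex_pin: "ex (\<lambda>\<sigma>. h \<sigma> * spin x s \<sigma>) = ex (\<lambda>\<sigma>. h (\<sigma>(x := s))) / real CARD('o)"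
proof -
  let ?E = "PiE ({..<n} - {x}) (\<lambda>_. UNIV :: 'o set)"
  have c: "(\<Sum>\<sigma>\<in>configs n. f \<sigma>) = (\<Sum>t\<in>UNIV. \<Sum>\<tau>\<in>?E. f (\<tau>(x := t)))" for f :: "_ \<Rightarrow> real"
    using sum_PiE_insert[of x "{..<n} - {x}" f] x by (simp add: configs_def insert_absorb)
  have "ex (\<lambda>\<sigma>. h (\<sigma>(x := s))) = (\<Sum>t\<in>(UNIV::'o set). \<Sum>\<tau>\<in>?E. gibbs n G \<tau> * h (\<tau>(x := s)))"
    unfolding ex_def c by (simp add: gibbs_upd)
  moreover have "ex (\<lambda>\<sigma>. h \<sigma> * spin x s \<sigma>) = (\<Sum>\<tau>\<in>?E. gibbs n G \<tau> * h (\<tau>(x := s)))"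
    unfolding ex_def c by (subst sum.swap) (simp add: gibbs_upd spin_def of_bool_def if_distrib cong: if_cong)
  ultimately show ?thesis by simp
qed

lemma weight_of_upd: "weight_of c (\<sigma>(x := s)) = (\<Prod>b\<leftarrow>c. g s b \<sigma>)"
  by (simp add: weight_of_def g_def case_prod_unfold)

lemma marg_x:
  "marg n (c @ G) x s = ex (\<lambda>\<sigma>. \<Prod>b\<leftarrow>c. g s b \<sigma>) / (\<Sum>t\<in>UNIV. ex (\<lambda>\<sigma>. \<Prod>b\<leftarrow>c. g t b \<sigma>))"
proof -
  have "ex (weight_of c) = (\<Sum>t\<in>UNIV. ex (\<lambda>\<sigma>. weight_of c \<sigma> * spin x t \<sigma>))"
    unfolding ex_sum[symmetric] sum_distrib_left[symmetric] by (simp add: spin_def of_bool_def)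
  then show ?thesis unfolding marg_append ex_pin weight_of_upd
    by (simp add: sum_divide_distrib[symmetric])
qed

lemma marg_x1: "marg n (b # G) x s = ex (g s b) / (\<Sum>t\<in>UNIV. ex (g t b))"
  using marg_x[of "[b]" s] by simp

text \<open>After pinning, the equation compares the expectation of a product of weights with the
  product of expectations, which is \<open>devl\<close>. The normalisers of the single messages do
  not depend on the spin and cancel.\<close>

lemma first_err_le:
  assumes c: "set c \<subseteq> set_pmf P"
  shows "(\<Sum>s\<in>UNIV. \<bar>marg n (c @ G) x s
         - (\<Prod>b'\<leftarrow>c. marg n (b' # G) x s) / (\<Sum>t\<in>UNIV. \<Prod>b'\<leftarrow>c. marg n (b' # G) x t)\<bar>)
     \<le> 2 / lo ^ length c * (\<Sum>s\<in>UNIV. devl s (\<lambda>_. 1) c)"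
proof -
  define A where "A s = ex (\<lambda>\<sigma>. \<Prod>b\<leftarrow>c. g s b \<sigma>)" for s
  define B where "B s = (\<Prod>b\<leftarrow>c. ex (g s b))" for s
  define Z where "Z = (\<Prod>b\<leftarrow>c. \<Sum>t\<in>UNIV. ex (g t b))"
  have gpos: "ex (g t b) > 0" if "b \<in> set c" for t b
    using ex_g_bounds(1)[of b t] that c lo by fastforce
  have Z: "Z > 0" unfolding Z_def by (intro prod_list_pos sum_pos gpos) auto
  have Bpos: "B s > 0" for s unfolding B_def by (intro prod_list_pos gpos)
  have Alo: "lo ^ length c \<le> A s" for s
  proof -
    have "lo ^ length c \<le> (\<Prod>b\<leftarrow>c. g s b \<sigma>) \<and> (\<Prod>b\<leftarrow>c. g s b \<sigma>) \<le> hi ^ length c" for \<sigma>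
      using g_bounds[of _ s \<sigma>] c by (intro prod_list_bounds) auto
    then show ?thesis unfolding A_def by (intro ex_bounds(1)) auto
  qed
  have "A s \<ge> 0" for s using Alo[of s] lo_power_pos[of "length c"] by linarith
  \<comment> \<open>\<open>undefined\<close> serves as an arbitrary spin: one term already bounds
    the sum of nonnegative terms from below.\<close>
  then have "A undefined \<le> sum A UNIV" by (intro member_le_sum) auto
  with Alo[of undefined] have sumA: "lo ^ length c \<le> sum A UNIV" by linarith
  have m: "(\<Prod>b'\<leftarrow>c. marg n (b' # G) x s) = B s / Z" for s
    by (simp add: marg_x1 prod_list_divide B_def Z_def)
  have m': "B s / Z / (\<Sum>t\<in>UNIV. B t / Z) = B s / sum B UNIV" for s
    using Z by (simp add: sum_divide_distrib[symmetric])
  have "(\<Sum>s\<in>UNIV. \<bar>A s / sum A UNIV - B s / sum B UNIV\<bar>) \<le> 2 / lo ^ length c * (\<Sum>s\<in>UNIV. \<bar>A s - B s\<bar>)"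
    using Bpos by (intro sum_normalize_diff_le lo_power_pos sumA sum_pos) (auto intro: less_imp_le)
  then show ?thesis unfolding m m' marg_x A_def[symmetric]
    by (simp add: devl_def A_def B_def ex_const)
qed

text \<open>The shift of the marginal at \<open>y\<close> caused by attaching \<open>c\<close>. The
  value 0 at \<open>x\<close> is harmless, since the Belief Propagation product omits
  \<open>x\<close>, and it meets the requirement \<open>e x = 0\<close> of
  \<open>hit_sum\<close>.\<close>

definition mdev :: "'o fgraph \<Rightarrow> nat \<Rightarrow> real" where
  "mdev c y = (if y = x then 0 else \<Sum>t\<in>UNIV. \<bar>marg n (c @ G) y t - ex (spin y t)\<bar>)"

lemma mdev_nonneg: "mdev c y \<ge> 0"
  unfolding mdev_def by (auto intro: sum_nonneg)

text \<open>The shift is the covariance of the spin with the total weight of \<open>c\<close>,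
  divided by the mean weight; hence \<open>bessel\<close> applies with \<open>hi ^ length c\<close>,
  and the divisor is at least \<open>lo ^ length c\<close>.\<close>

lemma pavg_mdev:
  assumes c: "set c \<subseteq> set_pmf P"
  shows "pavg U (mdev c) \<le> real CARD('o) * ((hi / lo) ^ length c * sqrt corr)"
proof -
  let ?w = "weight_of c" and ?r = "length c"
  have w: "lo ^ ?r \<le> ex ?w" using ex_weight_bounds[OF c] .
  have lop: "lo ^ ?r > 0" by (rule lo_power_pos)
  have "mdev c y \<le> (\<Sum>t\<in>UNIV. \<bar>cov ?w (spin y t)\<bar> / lo ^ ?r)" for y
  proof -
    have "\<bar>marg n (c @ G) y t - ex (spin y t)\<bar> = \<bar>cov ?w (spin y t)\<bar> / ex ?w" for t
    proof -
      have "marg n (c @ G) y t - ex (spin y t) = cov ?w (spin y t) / ex ?w"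
        using w lop unfolding marg_append cov_def by (simp add: field_simps)
      then show ?thesis using w lop by simp
    qed
    then have "\<bar>marg n (c @ G) y t - ex (spin y t)\<bar> \<le> \<bar>cov ?w (spin y t)\<bar> / lo ^ ?r" for t
      using w lop by (auto intro!: divide_left_mono)
    then show ?thesis unfolding mdev_def using lop by (auto intro!: sum_mono sum_nonneg)
  qed
  then have "(\<Sum>y<n. mdev c y) \<le> (\<Sum>y<n. \<Sum>t\<in>UNIV. \<bar>cov ?w (spin y t)\<bar> / lo ^ ?r)"
    by (intro sum_mono)
  also have "\<dots> = (\<Sum>t\<in>UNIV. (\<Sum>y<n. \<bar>cov ?w (spin y t)\<bar>) / lo ^ ?r)"
    by (subst sum.swap) (simp add: sum_divide_distrib)
  also have "\<dots> \<le> (\<Sum>t\<in>(UNIV::'o set). (real n * (hi ^ ?r * sqrt corr)) / lo ^ ?r)"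
  proof (intro sum_mono divide_right_mono bessel)
    fix \<sigma>
    show "\<bar>?w \<sigma>\<bar> \<le> hi ^ ?r"
      using weight_of_bounds[OF c, of \<sigma>] lop by linarith
  qed (use lop in auto)
  also have "\<dots> = real n * (real CARD('o) * ((hi / lo) ^ ?r * sqrt corr))"
    by (simp add: power_divide mult_ac)
  finally show ?thesis using n_pos by (simp add: pavg_uniform field_simps)
qed

lemma marg_prob:
  assumes c: "set c \<subseteq> set_pmf P"
  shows "marg n (c @ G) y t \<ge> 0" "(\<Sum>t\<in>UNIV. marg n (c @ G) y t) = 1"
proof -
  have w: "0 < ex (weight_of c)" using ex_weight_bounds[OF c] lo_power_pos by (rule less_le_trans[rotated])
  have "0 \<le> weight_of c \<sigma>" for \<sigma>
    using weight_of_bounds(1)[OF c, of \<sigma>] lo_power_pos[of "length c"] by linarith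
  then have "0 \<le> ex (\<lambda>\<sigma>. weight_of c \<sigma> * spin y t \<sigma>)"
    using ex_mono[of "\<lambda>_. 0" "\<lambda>\<sigma>. weight_of c \<sigma> * spin y t \<sigma>"] by (simp add: ex_const spin_def)
  then show "marg n (c @ G) y t \<ge> 0" using w by (simp add: marg_append)
  have "(\<Sum>t\<in>UNIV. ex (\<lambda>\<sigma>. weight_of c \<sigma> * spin y t \<sigma>)) = ex (weight_of c)"
    unfolding ex_sum[symmetric] sum_distrib_left[symmetric] by (simp add: spin_def of_bool_def)
  then show "(\<Sum>t\<in>UNIV. marg n (c @ G) y t) = 1"
    using w by (simp add: marg_append sum_divide_distrib[symmetric])
qed

lemma spin_prob: "ex (spin y t) \<ge> 0" "(\<Sum>t\<in>UNIV. ex (spin y t)) = 1"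
proof -
  show "ex (spin y t) \<ge> 0"
    using ex_mono[of "\<lambda>_. 0" "spin y t"] by (simp add: ex_const spin_def)
  show "(\<Sum>t\<in>UNIV. ex (spin y t)) = 1"
    by (simp add: ex_sum[symmetric] spin_def of_bool_def ex_const)
qed

text \<open>The comparison passes through \<open>gbar\<close>. The true expectation differs from it
  by \<open>dev\<close>; the numerator \<open>N\<close> differs from it by \<open>mdev\<close>,
  because its marginals are taken with \<open>c\<close> attached instead of in \<open>G\<close>
  alone.\<close>

lemma second_err_le:
  assumes b: "b \<in> set_pmf P" and h: "hits b" and c: "set c \<subseteq> set_pmf P"
  shows "(\<Sum>s\<in>UNIV. \<bar>marg n (b # G) x s
         - (\<Sum>\<tau>\<in>PiE (set (snd b)) (\<lambda>_. UNIV).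
              (if \<tau> x = s then fst b (map \<tau> (snd b)) *
                 (\<Prod>y\<in>set (snd b) - {x}. marg n (c @ G) y (\<tau> y)) else 0))
           / (\<Sum>\<tau>\<in>PiE (set (snd b)) (\<lambda>_. UNIV).
               fst b (map \<tau> (snd b)) *
                 (\<Prod>y\<in>set (snd b) - {x}. marg n (c @ G) y (\<tau> y)))\<bar>)
     \<le> 2 / lo * (\<Sum>s\<in>UNIV. hi * dev x s (\<lambda>_. 1) (set (snd b)) + hi * (\<Sum>y\<leftarrow>snd b. mdev c y))"
proof -
  let ?Y = "set (snd b)" and ?Y' = "set (snd b) - {x}"
  let ?m = "\<lambda>y t. marg n (c @ G) y t" and ?w = "\<lambda>\<tau>. fst b (map \<tau> (snd b))"
  define N where "N s = (\<Sum>\<tau>\<in>PiE ?Y (\<lambda>_. UNIV). (if \<tau> x = s then ?w \<tau> * (\<Prod>y\<in>?Y'. ?m y (\<tau> y)) else 0))" for s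
  have den: "(\<Sum>\<tau>\<in>PiE ?Y (\<lambda>_. UNIV). ?w \<tau> * (\<Prod>y\<in>?Y'. ?m y (\<tau> y))) = sum N UNIV"
    unfolding N_def by (subst sum.swap) simp
  have split: "(\<Sum>\<tau>\<in>PiE ?Y (\<lambda>_. UNIV). if \<tau> x = s then ?w \<tau> * (\<Prod>y\<in>?Y'. u y (\<tau> y)) else 0)
      = (\<Sum>\<tau>\<in>PiE ?Y' (\<lambda>_. UNIV). ?w (\<tau>(x := s)) * (\<Prod>y\<in>?Y'. u y (\<tau> y)))" for s and u :: "nat \<Rightarrow> 'o \<Rightarrow> real"
  proof -
    have *: "(\<Prod>y\<in>?Y'. u y ((\<tau>(x := t)) y)) = (\<Prod>y\<in>?Y'. u y (\<tau> y))" for \<tau> t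
      by (intro prod.cong) auto
    have notin: "x \<notin> ?Y'" by simp
    have "(\<Sum>\<tau>\<in>PiE (insert x ?Y') (\<lambda>_. UNIV). if \<tau> x = s then ?w \<tau> * (\<Prod>y\<in>?Y'. u y (\<tau> y)) else 0)
      = (\<Sum>t\<in>UNIV. \<Sum>\<tau>\<in>PiE ?Y' (\<lambda>_. UNIV). if t = s then ?w (\<tau>(x := t)) * (\<Prod>y\<in>?Y'. u y (\<tau> y)) else 0)"
      unfolding sum_PiE_insert[OF notin] by (simp only: * fun_upd_same)
    also have "\<dots> = (\<Sum>\<tau>\<in>PiE ?Y' (\<lambda>_. UNIV). ?w (\<tau>(x := s)) * (\<Prod>y\<in>?Y'. u y (\<tau> y)))"
      by (subst sum.swap) simp
    finally show ?thesis unfolding insert_Diff[OF h] .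
  qed
  have gb: "gbar s b = (\<Sum>\<tau>\<in>PiE ?Y (\<lambda>_. UNIV). if \<tau> x = s then ?w \<tau> * (\<Prod>y\<in>?Y'. ex (spin y (\<tau> y))) else 0)" for s
    unfolding gbar_def
  proof (intro sum.cong refl)
    fix \<tau>
    have "(\<Prod>y\<in>?Y. ex (pspin x s y (\<tau> y))) = ex (pspin x s x (\<tau> x)) * (\<Prod>y\<in>?Y'. ex (pspin x s y (\<tau> y)))"
      using h by (intro prod.remove) auto
    also have "ex (pspin x s x (\<tau> x)) = of_bool (\<tau> x = s)"
      by (auto simp: pspin_def[abs_def] ex_const)
    also have "(\<Prod>y\<in>?Y'. ex (pspin x s y (\<tau> y))) = (\<Prod>y\<in>?Y'. ex (spin y (\<tau> y)))"
      by (intro prod.cong refl arg_cong[where f = ex]) (auto simp: pspin_def spin_def)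
    finally show "?w \<tau> * (\<Prod>y\<in>?Y. ex (pspin x s y (\<tau> y)))
      = (if \<tau> x = s then ?w \<tau> * (\<Prod>y\<in>?Y'. ex (spin y (\<tau> y))) else 0)" by simp
  qed
  have Nb: "\<bar>N s - gbar s b\<bar> \<le> hi * (\<Sum>y\<leftarrow>snd b. mdev c y)" for s
  proof -
    let ?D = "\<lambda>\<tau>. (\<Prod>y\<in>?Y'. ?m y (\<tau> y)) - (\<Prod>y\<in>?Y'. ex (spin y (\<tau> y)))"
    have "N s - gbar s b = (\<Sum>\<tau>\<in>PiE ?Y' (\<lambda>_. UNIV). ?w (\<tau>(x := s)) * ?D \<tau>)"
      unfolding N_def gb split[of s ?m] split[of s "\<lambda>y t. ex (spin y t)"] by (simp add: sum_subtractf[symmetric] right_diff_distrib)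
    also have "\<bar>\<dots>\<bar> \<le> (\<Sum>\<tau>\<in>PiE ?Y' (\<lambda>_. UNIV). \<bar>?w (\<tau>(x := s)) * ?D \<tau>\<bar>)" by (rule sum_abs)
    also have "\<dots> \<le> (\<Sum>\<tau>\<in>PiE ?Y' (\<lambda>_. UNIV). hi * \<bar>?D \<tau>\<bar>)"
    proof (intro sum_mono)
      fix \<tau>
      have "\<bar>?w (\<tau>(x := s))\<bar> \<le> hi" using weight_bounds_P[OF b, of "\<tau>(x := s)"] lo by linarith
      then show "\<bar>?w (\<tau>(x := s)) * ?D \<tau>\<bar> \<le> hi * \<bar>?D \<tau>\<bar>"
        unfolding abs_mult by (intro mult_right_mono) auto
    qed
    also have "\<dots> = hi * (\<Sum>\<tau>\<in>PiE ?Y' (\<lambda>_. UNIV). \<bar>?D \<tau>\<bar>)" by (simp add: sum_distrib_left)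
    also have "\<dots> \<le> hi * (\<Sum>y\<in>?Y'. \<Sum>t\<in>UNIV. \<bar>?m y t - ex (spin y t)\<bar>)"
      using hi by (intro mult_left_mono sum_prod_diff_le marg_prob[OF c] spin_prob) auto
    also have "(\<Sum>y\<in>?Y'. \<Sum>t\<in>UNIV. \<bar>?m y t - ex (spin y t)\<bar>) = (\<Sum>y\<in>?Y'. mdev c y)"
      by (intro sum.cong) (auto simp: mdev_def)
    also have "hi * \<dots> \<le> hi * (\<Sum>y\<leftarrow>snd b. mdev c y)"
    proof (intro mult_left_mono)
      have "(\<Sum>y\<in>?Y'. mdev c y) \<le> (\<Sum>y\<in>?Y. mdev c y)"
        by (intro sum_mono2) (auto simp: mdev_nonneg)
      also have "\<dots> \<le> (\<Sum>y\<leftarrow>snd b. mdev c y)" by (intro sum_set_le_sum_list mdev_nonneg)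
      finally show "(\<Sum>y\<in>?Y'. mdev c y) \<le> (\<Sum>y\<leftarrow>snd b. mdev c y)" .
    qed (use hi in auto)
    finally show ?thesis .
  qed
  have w0: "?w \<tau> \<ge> lo" for \<tau> by (rule weight_bounds_P[OF b])
  \<comment> \<open>The messages define a product probability measure, so \<open>N s\<close> is at
    least the smallest weight \<open>lo\<close>.\<close>
  have Npos: "N s > 0" for s
  proof -
    have "0 < lo * (\<Sum>\<tau>\<in>PiE ?Y' (\<lambda>_. UNIV). \<Prod>y\<in>?Y'. ?m y (\<tau> y))"
      using prod_sum_PiE[of ?Y' "\<lambda>_. UNIV" ?m] marg_prob(2)[OF c] lo by simp
    also have "\<dots> \<le> N s"
      unfolding N_def split sum_distrib_left using w0 marg_prob(1)[OF c]
      by (intro sum_mono mult_right_mono prod_nonneg) auto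
    finally show ?thesis .
  qed
  have sumg: "lo \<le> (\<Sum>t\<in>UNIV. ex (g t b))"
  proof -
    have "ex (g t b) \<ge> 0" for t using ex_g_bounds(1)[OF b, of t] lo by linarith
    then have "ex (g undefined b) \<le> (\<Sum>t\<in>UNIV. ex (g t b))"
      by (intro member_le_sum[of _ _ "\<lambda>t. ex (g t b)"]) auto
    with ex_g_bounds(1)[OF b, of undefined] show ?thesis by linarith
  qed
  have "(\<Sum>s\<in>UNIV. \<bar>ex (g s b) / (\<Sum>t\<in>UNIV. ex (g t b)) - N s / sum N UNIV\<bar>)
      \<le> 2 / lo * (\<Sum>s\<in>UNIV. \<bar>ex (g s b) - N s\<bar>)"
    using Npos by (intro sum_normalize_diff_le lo sumg sum_pos) (auto intro: less_imp_le)
  also have "\<dots> \<le> 2 / lo * (\<Sum>s\<in>UNIV. hi * dev x s (\<lambda>_. 1) ?Y + hi * (\<Sum>y\<leftarrow>snd b. mdev c y))"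
  proof (intro mult_left_mono sum_mono)
    fix s
    show "\<bar>ex (g s b) - N s\<bar> \<le> hi * dev x s (\<lambda>_. 1) ?Y + hi * (\<Sum>y\<leftarrow>snd b. mdev c y)"
      using Nb[of s] ex_g_gbar1[OF b, of s] by linarith
  qed (use lo in auto)
  finally show ?thesis unfolding den N_def[symmetric] marg_x1 .
qed

end

section \<open>Reordering of constraints and the averaged local error\<close>

lemma prod_list_perm:
  fixes f :: "'a \<Rightarrow> real"
  assumes "mset c = mset c'"
  shows "(\<Prod>b\<leftarrow>c. f b) = (\<Prod>b\<leftarrow>c'. f b)"
  unfolding prod_mset_prod_list[symmetric] mset_map assms ..

lemma marg_perm:
  assumes "mset G = mset G'"
  shows "marg n G = marg n G'"
proof -
  have w: "weight_of G = weight_of G'"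
    unfolding weight_of_def by (rule ext) (rule prod_list_perm[OF assms])
  show ?thesis
    unfolding marg_def[abs_def] gibbs_def partition_fun_def w ..
qed

lemma local_err_perm:
  assumes "mset c = mset c'"
  shows "local_err n x b c G = local_err n x b c' G"
proof -
  have 1: "marg n (c @ G) = marg n (c' @ G)" using assms by (intro marg_perm) simp
  show ?thesis unfolding local_err_def 1 prod_list_perm[OF assms] ..
qed

context gibbs_setting begin

lemma local_err_le:
  assumes "b \<in> set_pmf P" "hits b" "set c \<subseteq> set_pmf P"
  shows "local_err n x b c G \<le> 2 / lo ^ length c * (\<Sum>s\<in>UNIV. devl s (\<lambda>_. 1) c)
    + (2 / lo * hi * (\<Sum>s\<in>UNIV. dev x s (\<lambda>_. 1) (set (snd b)))
     + 2 / lo * hi * real CARD('o) * (\<Sum>y\<leftarrow>snd b. mdev c y))"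
proof -
  have "2 / lo * (\<Sum>s\<in>UNIV. hi * dev x s (\<lambda>_. 1) (set (snd b)) + hi * (\<Sum>y\<leftarrow>snd b. mdev c y))
     = 2 / lo * hi * (\<Sum>s\<in>UNIV. dev x s (\<lambda>_. 1) (set (snd b)))
     + 2 / lo * hi * real CARD('o) * (\<Sum>y\<leftarrow>snd b. mdev c y)"
    by (simp add: sum.distrib sum_distrib_left algebra_simps)
  moreover have "local_err n x b c G \<le> 2 / lo ^ length c * (\<Sum>s\<in>UNIV. devl s (\<lambda>_. 1) c)
      + 2 / lo * (\<Sum>s\<in>UNIV. hi * dev x s (\<lambda>_. 1) (set (snd b)) + hi * (\<Sum>y\<leftarrow>snd b. mdev c y))"
    unfolding local_err_def
    by (subst sum.distrib) (rule add_mono[OF first_err_le[OF assms(3)] second_err_le[OF assms]])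
  ultimately show ?thesis by (simp only:)
qed

text \<open>The summands belong, in order, to the three error sources \<open>devl\<close>,
  \<open>dev\<close> and \<open>mdev\<close> of \<open>local_err_le\<close>.\<close>

definition D :: real where
  "D = 2 * real CARD('o) * d + 2 / lo * hi * d * k * (real CARD('o) * real CARD('o) ^ k + real CARD('o) ^ 2)"

lemma D_nonneg: "D \<ge> 0"
  unfolding D_def using lo hi d_pos by (intro add_nonneg_nonneg mult_nonneg_nonneg) auto

lemma hit_local_err:
  "l ^ Suc r * pavg P (\<lambda>b. lavg P r (\<lambda>c. of_bool (hits b \<and> (\<forall>b'\<in>set c. hits b')) * local_err n x b c G))
     \<le> D * real (Suc r) * (M / lo) ^ r * sqrt corr"
proof -
  let ?R = "sqrt corr" and ?q = "real CARD('o)"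
  let ?I = "\<lambda>c. of_bool (\<forall>b\<in>set c. hits b) :: real" and ?h = "\<lambda>b. of_bool (hits b) :: real"
  let ?T2 = "\<lambda>b. \<Sum>s\<in>UNIV. dev x s (\<lambda>_. 1) (set (snd b))"
  let ?T3 = "\<lambda>b c. \<Sum>y\<leftarrow>snd b. mdev c y"
  let ?hp = "pavg P ?h" and ?A = "lavg P r ?I"
  have R: "?R \<ge> 0" using corr_nonneg by simp
  have lr: "l ^ r \<ge> 0" by (rule zero_le_power[OF l_nonneg])
  have A0: "?A \<ge> 0" by (intro lavg_nonneg) simp
  have hp0: "?hp \<ge> 0" by (intro pavg_nonneg) simp
  have lor: "lo ^ r > 0" by (rule lo_power_pos)
  have dr: "d ^ r \<le> (M / lo) ^ r"
  proof (intro power_mono)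
    have "d * lo \<le> M" using M_bounds(2) lo d_pos by (smt (verit) mult_left_le)
    then show "d \<le> M / lo" using lo by (simp add: field_simps)
  qed (use d_pos in auto)
  have hdr: "(hi / lo) ^ r * d ^ r \<le> (M / lo) ^ r"
    unfolding power_mult_distrib[symmetric] using M_bounds(3) lo hi d_pos
    by (intro power_mono) (auto simp: field_simps)
  \<comment> \<open>The constraint \<open>b\<close> is independent of \<open>c\<close>. The
    integrands of \<open>E1\<close> and \<open>E2\<close> are products of a function of
    \<open>b\<close> and a function of \<open>c\<close>, so these averages factorise.\<close>
  define E1 where "E1 = l ^ Suc r * pavg P (\<lambda>b. lavg P r (\<lambda>c. ?h b * (?I c * (\<Sum>s\<in>UNIV. devl s (\<lambda>_. 1) c))))"
  define E2 where "E2 = l ^ Suc r * pavg P (\<lambda>b. lavg P r (\<lambda>c. (?h b * ?T2 b) * ?I c))"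
  define E3 where "E3 = l ^ Suc r * pavg P (\<lambda>b. lavg P r (\<lambda>c. ?I c * (?h b * ?T3 b c)))"
  have E1: "E1 \<le> ?q * (d * (r * M ^ r * ?R))"
  proof -
    have "E1 = (\<Sum>s\<in>UNIV. (l * ?hp) * (l ^ r * lavg P r (\<lambda>c. ?I c * devl s (\<lambda>_. 1) c)))"
    proof -
      have "pavg P (\<lambda>b. lavg P r (\<lambda>c. ?h b * (?I c * (\<Sum>s\<in>UNIV. devl s (\<lambda>_. 1) c))))
          = ?hp * lavg P r (\<lambda>c. ?I c * (\<Sum>s\<in>UNIV. devl s (\<lambda>_. 1) c))"
        unfolding lavg_cmult by (rule pavg_cmult_right)
      also have "lavg P r (\<lambda>c. ?I c * (\<Sum>s\<in>UNIV. devl s (\<lambda>_. 1) c))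
          = (\<Sum>s\<in>UNIV. lavg P r (\<lambda>c. ?I c * devl s (\<lambda>_. 1) c))"
        unfolding sum_distrib_left lavg_sum ..
      finally show ?thesis unfolding E1_def by (simp add: sum_distrib_left mult_ac)
    qed
    also have "\<dots> \<le> (\<Sum>s\<in>(UNIV::'o set). d * (real r * 1 * M ^ r * ?R))"
    proof (rule sum_mono, rule mult_mono[OF hit_prob hit_devl])
      fix s
      show "0 \<le> l ^ r * lavg P r (\<lambda>c. ?I c * devl s (\<lambda>_. 1) c)"
        by (intro mult_nonneg_nonneg[OF lr] lavg_nonneg) (simp add: devl_def)
    qed (use d_pos in auto)
    finally show ?thesis by simp
  qed
  have E2: "E2 \<le> ?q * (d * (k * ?q ^ k * ?R)) * (M / lo) ^ r"
  proof -
    have "pavg P (\<lambda>b. lavg P r (\<lambda>c. (?h b * ?T2 b) * ?I c)) = ?A * pavg P (\<lambda>b. ?h b * ?T2 b)"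
      unfolding lavg_cmult by (subst pavg_cmult[symmetric]) (simp only: mult.commute)
    then have "E2 = (l * pavg P (\<lambda>b. ?h b * ?T2 b)) * (l ^ r * ?A)"
      unfolding E2_def by (simp add: mult_ac)
    also have "pavg P (\<lambda>b. ?h b * ?T2 b) = (\<Sum>s\<in>UNIV. pavg P (\<lambda>b. ?h b * dev x s (\<lambda>_. 1) (set (snd b))))"
      unfolding sum_distrib_left pavg_sum ..
    also have "l * \<dots> = (\<Sum>s\<in>UNIV. l * pavg P (\<lambda>b. ?h b * dev x s (\<lambda>_. 1) (set (snd b))))"
      by (rule sum_distrib_left)
    also have "\<dots> * (l ^ r * ?A) \<le> (\<Sum>s\<in>(UNIV::'o set). d * (k * ?q ^ k * (1 * ?R))) * (M / lo) ^ r"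
    proof (rule mult_mono)
      show "(\<Sum>s\<in>UNIV. l * pavg P (\<lambda>b. ?h b * dev x s (\<lambda>_. 1) (set (snd b))))
          \<le> (\<Sum>s\<in>(UNIV::'o set). d * (k * ?q ^ k * (1 * ?R)))"
        by (rule sum_mono, rule hit_dev) simp
      show "l ^ r * ?A \<le> (M / lo) ^ r" using hit_all_prob[of r] dr by linarith
      show "0 \<le> (\<Sum>s\<in>(UNIV::'o set). d * (k * ?q ^ k * (1 * ?R)))"
        using d_pos R by (intro sum_nonneg) auto
      show "0 \<le> l ^ r * ?A" by (rule mult_nonneg_nonneg[OF lr A0])
    qed
    finally show ?thesis by simp
  qed
  have E3: "E3 \<le> d * k * ?q * ?R * (M / lo) ^ r"
  proof -
    \<comment> \<open>Here \<open>b\<close> and \<open>c\<close> interact. Averaging over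
      \<open>b\<close> first, for fixed \<open>c\<close>, gives a bound that depends on
      \<open>c\<close> only through its length.\<close>
    have "E3 = l ^ r * lavg P r (\<lambda>c. ?I c * (l * pavg P (\<lambda>b. ?h b * ?T3 b c)))"
      unfolding E3_def pavg_lavg_swap pavg_cmult by (simp add: lavg_cmult[symmetric] mult_ac)
    also have "\<dots> \<le> l ^ r * lavg P r (\<lambda>c. (d * (k * (?q * ((hi / lo) ^ r * ?R)))) * ?I c)"
    proof (intro mult_left_mono lavg_mono lr)
      fix c :: "'o fgraph" assume c: "length c = r" "set c \<subseteq> set_pmf P"
      have "l * pavg P (\<lambda>b. ?h b * ?T3 b c) \<le> d * (k * pavg U (mdev c))"
        by (intro hit_sum mdev_nonneg) (simp add: mdev_def)
      also have "\<dots> \<le> d * (k * (?q * ((hi / lo) ^ r * ?R)))"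
        using pavg_mdev[OF c(2)] c(1) d_pos by (intro mult_left_mono) auto
      finally show "?I c * (l * pavg P (\<lambda>b. ?h b * ?T3 b c)) \<le> (d * (k * (?q * ((hi / lo) ^ r * ?R)))) * ?I c"
        by simp
    qed
    also have "\<dots> = (d * (k * (?q * ((hi / lo) ^ r * ?R)))) * (l ^ r * ?A)"
      unfolding lavg_cmult by (rule mult.left_commute)
    also have "\<dots> \<le> (d * (k * (?q * ((hi / lo) ^ r * ?R)))) * d ^ r"
      using d_pos R hi lo by (intro mult_left_mono hit_all_prob) auto
    also have "\<dots> = d * k * ?q * ?R * ((hi / lo) ^ r * d ^ r)" by (simp only: mult_ac)
    also have "\<dots> \<le> d * k * ?q * ?R * (M / lo) ^ r"
      using d_pos R by (intro mult_left_mono hdr) auto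
    finally show ?thesis .
  qed
  have "pavg P (\<lambda>b. lavg P r (\<lambda>c. of_bool (hits b \<and> (\<forall>b'\<in>set c. hits b')) * local_err n x b c G))
     \<le> pavg P (\<lambda>b. lavg P r (\<lambda>c. 2 / lo ^ r * (?h b * (?I c * (\<Sum>s\<in>UNIV. devl s (\<lambda>_. 1) c)))
         + (2 / lo * hi * ((?h b * ?T2 b) * ?I c) + 2 / lo * hi * ?q * (?I c * (?h b * ?T3 b c)))))"
    using local_err_le by (intro pavg_mono lavg_mono) auto
  also have "\<dots> = 2 / lo ^ r * pavg P (\<lambda>b. lavg P r (\<lambda>c. ?h b * (?I c * (\<Sum>s\<in>UNIV. devl s (\<lambda>_. 1) c))))
      + (2 / lo * hi * pavg P (\<lambda>b. lavg P r (\<lambda>c. (?h b * ?T2 b) * ?I c))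
      + 2 / lo * hi * ?q * pavg P (\<lambda>b. lavg P r (\<lambda>c. ?I c * (?h b * ?T3 b c))))"
    by (simp only: lavg_add pavg_add lavg_cmult[of _ _ "2 / lo ^ r"] lavg_cmult[of _ _ "2 / lo * hi"]
      lavg_cmult[of _ _ "2 / lo * hi * ?q"] pavg_cmult)
  finally have "l ^ Suc r * pavg P (\<lambda>b. lavg P r (\<lambda>c. of_bool (hits b \<and> (\<forall>b'\<in>set c. hits b')) * local_err n x b c G))
     \<le> l ^ Suc r * \<dots>" by (rule mult_left_mono) (rule zero_le_power[OF l_nonneg])
  also have "\<dots> = 2 / lo ^ r * E1 + (2 / lo * hi * E2 + 2 / lo * hi * ?q * E3)"
    unfolding E1_def E2_def E3_def by (simp only: distrib_left mult_ac)
  also have "\<dots> \<le> 2 / lo ^ r * (?q * (d * (r * M ^ r * ?R))) + (2 / lo * hi * (?q * (d * (k * ?q ^ k * ?R)) * (M / lo) ^ r)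
      + 2 / lo * hi * ?q * (d * k * ?q * ?R * (M / lo) ^ r))"
    using lo hi lor by (intro add_mono mult_left_mono E1 E2 E3) auto
  also have "\<dots> = (2 * ?q * d * r + 2 / lo * hi * d * k * (?q * ?q ^ k + ?q ^ 2)) * ((M / lo) ^ r * ?R)"
    by (simp add: power_divide add_divide_distrib power2_eq_square algebra_simps)
  also have "\<dots> \<le> (D * real (Suc r)) * ((M / lo) ^ r * ?R)"
  proof (intro mult_right_mono)
    let ?z = "2 / lo * hi * d * k * (?q * ?q ^ k + ?q ^ 2)"
    have "0 \<le> ?z" "0 \<le> 2 * ?q * d" using lo hi d_pos by auto
    moreover from this(1) have "0 \<le> ?z * r" by (rule mult_nonneg_nonneg) simp
    ultimately show "2 * ?q * d * r + ?z \<le> D * real (Suc r)"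
      unfolding D_def by (simp only: of_nat_Suc distrib_left distrib_right)
    show "0 \<le> (M / lo) ^ r * ?R" using M_bounds lo R by auto
  qed
  finally show ?thesis by (simp only: mult.assoc)
qed

text \<open>One factor \<open>r\<close> comes from the choice of the distinguished constraint by
  \<open>lavg_sum_remove1\<close>, another from the accumulated error. Both are absorbed by
  \<open>r < 2 ^ r\<close>, whence the 4, leaving a pure power to sum against Poisson
  weights.\<close>

lemma hit_sum_local_err:
  "l ^ r * lavg P r (\<lambda>c. of_bool (\<forall>b\<in>set c. hits b) * (\<Sum>b\<leftarrow>c. local_err n x b (remove1 b c) G))
     \<le> D * (4 * (M / lo)) ^ r * sqrt corr"
proof (cases r)
  case 0
  then show ?thesis using D_nonneg corr_nonneg by simp
next
  case (Suc m)
  let ?f = "\<lambda>b c. of_bool (hits b \<and> (\<forall>b'\<in>set c. hits b')) * local_err n x b c G"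
  have "of_bool (\<forall>b\<in>set c. hits b) * (\<Sum>b\<leftarrow>c. local_err n x b (remove1 b c) G)
      = (\<Sum>b\<leftarrow>c. ?f b (remove1 b c))" for c
  proof -
    have "(\<forall>b\<in>set c. hits b) \<longleftrightarrow> (hits b \<and> (\<forall>b'\<in>set (remove1 b c). hits b'))" if "b \<in> set c" for b
    proof -
      have "mset c = mset (b # remove1 b c)" using that by simp
      then show ?thesis using mset_eq_setD by fastforce
    qed
    then have "(\<Sum>b\<leftarrow>c. ?f b (remove1 b c))
        = (\<Sum>b\<leftarrow>c. of_bool (\<forall>b\<in>set c. hits b) * local_err n x b (remove1 b c) G)"
      by (intro arg_cong[where f = sum_list] map_cong) auto
    then show ?thesis by (simp add: sum_list_const_mult)
  qed
  then have "l ^ r * lavg P r (\<lambda>c. of_bool (\<forall>b\<in>set c. hits b) * (\<Sum>b\<leftarrow>c. local_err n x b (remove1 b c) G))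
      = l ^ Suc m * lavg P (Suc m) (\<lambda>c. \<Sum>b\<leftarrow>c. ?f b (remove1 b c))" by (simp only: Suc)
  also have "\<dots> = l ^ Suc m * (real (Suc m) * pavg P (\<lambda>b. lavg P m (?f b)))"
  proof (subst lavg_sum_remove1)
    fix b and c c' :: "'o fgraph" assume m: "mset c = mset c'"
    then show "?f b c = ?f b c'" using local_err_perm[OF m] mset_eq_setD[OF m] by simp
  qed simp
  also have "\<dots> = real (Suc m) * (l ^ Suc m * pavg P (\<lambda>b. lavg P m (?f b)))" by (rule mult.left_commute)
  also have "\<dots> \<le> real (Suc m) * (D * real (Suc m) * (M / lo) ^ m * sqrt corr)"
    by (intro mult_left_mono hit_local_err) auto
  also have "\<dots> = (real (Suc m) * real (Suc m) * (M / lo) ^ m) * (D * sqrt corr)" by (simp only: mult_ac)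
  also have "\<dots> \<le> (4 ^ Suc m * (M / lo) ^ Suc m) * (D * sqrt corr)"
  proof (intro mult_right_mono mult_mono)
    have "real (Suc m) \<le> 2 ^ Suc m" using of_nat_less_two_power[of "Suc m", where 'a = real] by linarith
    then have "real (Suc m) * real (Suc m) \<le> 2 ^ Suc m * 2 ^ Suc m" by (intro mult_mono) auto
    then show "real (Suc m) * real (Suc m) \<le> 4 ^ Suc m" by (simp add: power_mult_distrib[symmetric])
    have "1 \<le> M / lo" using M_bounds(1) lo by (simp add: field_simps)
    then show "(M / lo) ^ m \<le> (M / lo) ^ Suc m" by (intro power_increasing) auto
  qed (use D_nonneg corr_nonneg M_bounds lo in auto)
  finally show ?thesis by (simp only: Suc power_mult_distrib mult_ac)
qed

end

section \<open>Decomposition of the Belief Propagation error\<close>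

lemma mset_filter_nth:
  "mset (filter Q G) = image_mset (nth G) (mset_set {i. i < length G \<and> Q (G ! i)})"
proof -
  let ?js = "filter (\<lambda>i. Q (G ! i)) [0..<length G]"
  have "filter Q G = map (nth G) ?js"
    by (metis (no_types, lifting) comp_apply filter_cong filter_map map_nth)
  moreover have "mset ?js = mset_set (set ?js)" by (subst mset_set_set) auto
  moreover have "set ?js = {i. i < length G \<and> Q (G ! i)}" by auto
  ultimately show ?thesis by (simp only: mset_map)
qed

lemma mset_del_constraints:
  "mset (del_constraints G D) = image_mset (nth G) (mset_set ({..<length G} - D))"
proof -
  let ?js = "filter (\<lambda>i. i \<notin> D) [0..<length G]"
  have "mset ?js = mset_set (set ?js)" by (subst mset_set_set) auto
  moreover have "set ?js = {..<length G} - D" by auto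
  ultimately show ?thesis by (simp only: del_constraints_def mset_map)
qed

lemma bp_error_nonneg: "bp_error n G \<ge> 0"
  unfolding bp_error_def by (intro sum_nonneg add_nonneg_nonneg) auto

text \<open>Messages are indexed by positions, local errors by list entries, and equal constraints
  may occur repeatedly. Gibbs marginals ignore the order of constraints, so it suffices to match
  multisets, which retain multiplicity.\<close>

lemma bp_error_eq_sum_local_err:
  fixes G :: "'o::finite fgraph"
  shows "bp_error n G = (\<Sum>x<n. \<Sum>b\<leftarrow>filter (\<lambda>b. x \<in> set (snd b)) G.
     local_err n x b (remove1 b (filter (\<lambda>b. x \<in> set (snd b)) G)) (filter (\<lambda>b. x \<notin> set (snd b)) G))"
  unfolding bp_error_def
proof (rule sum.cong[OF refl])
  fix x
  let ?Q = "\<lambda>b :: 'o weight \<times> nat list. x \<in> set (snd b)"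
  let ?c = "filter ?Q G" and ?H = "filter (\<lambda>b. \<not> ?Q b) G"
  define I where "I = adj_var G x"
  have I: "I = {i. i < length G \<and> ?Q (G ! i)}" by (simp add: I_def adj_var_def)
  have finI: "finite I" unfolding I by simp
  have c: "mset ?c = image_mset (nth G) (mset_set I)" unfolding I by (rule mset_filter_nth)
  have "{i. i < length G \<and> \<not> ?Q (G ! i)} = {..<length G} - I" unfolding I by auto
  then have H: "mset ?H = image_mset (nth G) (mset_set ({..<length G} - I))"
    using mset_filter_nth[of "\<lambda>b. \<not> ?Q b" G] by simp
  have rem: "mset (remove1 (G ! a) ?c) = image_mset (nth G) (mset_set (I - {a}))" if "a \<in> I" for a
  proof -
    have "mset_set I = add_mset a (mset_set (I - {a}))" using that finI by (rule mset_set.remove[rotated])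
    then show ?thesis using c by simp
  qed
  \<comment> \<open>Deleting \<open>a\<close> leaves the other constraints at \<open>x\<close> and
    all those away from \<open>x\<close>.\<close>
  have va: "msg_va n G y a = marg n (remove1 (G ! a) ?c @ ?H) y" if "a \<in> I" for y a
  proof -
    have "mset_set ({..<length G} - {a}) = mset_set (I - {a}) + mset_set ({..<length G} - I)"
      using finI that I by (subst mset_set_Union[symmetric]) (auto intro!: arg_cong[where f = mset_set])
    then have m: "mset (del_constraints G {a}) = mset (remove1 (G ! a) ?c @ ?H)"
      unfolding mset_append rem[OF that] H mset_del_constraints by simp
    show ?thesis unfolding msg_va_def marg_perm[OF m] ..
  qed
  \<comment> \<open>Deleting the other constraints at \<open>x\<close> leaves \<open>a\<close> alone
    on top of those away from \<open>x\<close>.\<close>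
  have av: "msg_av n G a x = marg n (G ! a # ?H) x" if "a \<in> I" for a
  proof -
    have "{..<length G} - (I - {a}) = insert a ({..<length G} - I)" using that I by auto
    then have m: "mset (del_constraints G (I - {a})) = mset (G ! a # ?H)"
      unfolding mset.simps H mset_del_constraints using that by simp
    show ?thesis unfolding msg_av_def I_def[symmetric] marg_perm[OF m] ..
  qed
  have prod: "(\<Prod>b\<in>I - {a}. msg_av n G b x s) = (\<Prod>b\<leftarrow>remove1 (G ! a) ?c. marg n (b # ?H) x s)"
    if "a \<in> I" for a s
  proof -
    have "(\<Prod>b\<in>I - {a}. msg_av n G b x s) = (\<Prod>b\<in>I - {a}. marg n (G ! b # ?H) x s)"
      by (intro prod.cong) (auto simp: av)
    also have "\<dots> = prod_mset (image_mset (\<lambda>b. marg n (b # ?H) x s) (mset (remove1 (G ! a) ?c)))"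
      unfolding rem[OF that] prod_unfold_prod_mset by (simp add: image_mset.compositionality comp_def)
    also have "\<dots> = (\<Prod>b\<leftarrow>remove1 (G ! a) ?c. marg n (b # ?H) x s)"
      by (simp only: mset_map[symmetric] prod_mset_prod_list)
    finally show ?thesis .
  qed
  let ?f = "\<lambda>b. local_err n x b (remove1 b ?c) ?H"
  have "(\<Sum>a\<in>I. ?f (G ! a)) = sum_mset (image_mset ?f (mset ?c))"
    unfolding c sum_unfold_sum_mset by (simp add: image_mset.compositionality comp_def)
  also have "\<dots> = (\<Sum>b\<leftarrow>?c. ?f b)" by (simp only: mset_map[symmetric] sum_mset_sum_list)
  finally have fin: "(\<Sum>a\<in>I. ?f (G ! a)) = (\<Sum>b\<leftarrow>?c. ?f b)" .
  show "(\<Sum>a\<in>adj_var G x. \<Sum>s\<in>(UNIV::'o set).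
       \<bar>msg_va n G x a s
         - (\<Prod>b\<in>adj_var G x - {a}. msg_av n G b x s)
           / (\<Sum>t\<in>UNIV. \<Prod>b\<in>adj_var G x - {a}. msg_av n G b x t)\<bar>
     + \<bar>msg_av n G a x s
         - (\<Sum>\<tau>\<in>PiE (vars_of G a) (\<lambda>_. UNIV).
              (if \<tau> x = s then fst (G ! a) (map \<tau> (snd (G ! a))) *
                 (\<Prod>y\<in>vars_of G a - {x}. msg_va n G y a (\<tau> y)) else 0))
           / (\<Sum>\<tau>\<in>PiE (vars_of G a) (\<lambda>_. UNIV).
               fst (G ! a) (map \<tau> (snd (G ! a))) *
                 (\<Prod>y\<in>vars_of G a - {x}. msg_va n G y a (\<tau> y)))\<bar>) = (\<Sum>b\<leftarrow>?c. ?f b)"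
    unfolding fin[symmetric] I_def[symmetric] unfolding local_err_def vars_of_def
    by (rule sum.cong[OF refl]) (simp only: va av prod)
qed

section \<open>Finite averages as integrals, and Markov's inequality\<close>

lemma nn_integral_replicate_pmf:
  assumes p: "finite (set_pmf p)" and F: "\<And>c. F c \<ge> 0"
  shows "(\<integral>\<^sup>+c. ennreal (F c) \<partial>replicate_pmf r p) = ennreal (lavg p r F)"
  using F
proof (induction r arbitrary: F)
  case (Suc r)
  have "(\<integral>\<^sup>+c. ennreal (F c) \<partial>replicate_pmf (Suc r) p) = (\<integral>\<^sup>+b. ennreal (lavg p r (\<lambda>c. F (b # c))) \<partial>p)"
    using Suc.prems by (simp add: Suc.IH)
  also have "\<dots> = (\<Sum>b\<in>set_pmf p. ennreal (lavg p r (\<lambda>c. F (b # c))) * ennreal (pmf p b))"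
    using p by (intro nn_integral_measure_pmf_finite) auto
  also have "\<dots> = (\<Sum>b\<in>set_pmf p. ennreal (pmf p b * lavg p r (\<lambda>c. F (b # c))))"
    using Suc.prems by (intro sum.cong) (auto simp: ennreal_mult'' mult.commute lavg_nonneg)
  also have "\<dots> = ennreal (lavg p (Suc r) F)"
    using Suc.prems by (subst sum_ennreal) (auto simp: pavg_def intro!: mult_nonneg_nonneg lavg_nonneg)
  finally show ?case .
qed simp

text \<open>Partial sums fit the form of \<open>poisson_thinning_bound\<close>; the supremum needs
  no summability.\<close>

lemma nn_integral_poisson_list:
  assumes p: "finite (set_pmf p)" and l: "l > 0" and F: "\<And>c. F c \<ge> 0"
  shows "(\<integral>\<^sup>+c. ennreal (F c) \<partial>bind_pmf (poisson_pmf l) (\<lambda>m. replicate_pmf m p))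
    = (SUP N. ennreal (\<Sum>m<N. l ^ m / fact m * exp (- l) * lavg p m F))"
proof -
  have nn: "0 \<le> l ^ m / fact m * exp (- l) * lavg p m F" for m
    using l F by (intro mult_nonneg_nonneg lavg_nonneg) auto
  have "(\<integral>\<^sup>+c. ennreal (F c) \<partial>bind_pmf (poisson_pmf l) (\<lambda>m. replicate_pmf m p))
      = (\<integral>\<^sup>+m. ennreal (lavg p m F) \<partial>poisson_pmf l)"
    by (simp only: nn_integral_bind_pmf nn_integral_replicate_pmf[OF p F])
  also have "\<dots> = (\<Sum>m. ennreal (pmf (poisson_pmf l) m) * ennreal (lavg p m F))"
    by (simp only: nn_integral_measure_pmf nn_integral_count_space_nat)
  also have "\<dots> = (\<Sum>m. ennreal (l ^ m / fact m * exp (- l) * lavg p m F))"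
    using l F by (intro suminf_cong) (simp add: ennreal_mult''[symmetric] lavg_nonneg)
  also have "\<dots> = (SUP N. ennreal (\<Sum>m<N. l ^ m / fact m * exp (- l) * lavg p m F))"
    using nn by (simp add: suminf_eq_SUP sum_ennreal)
  finally show ?thesis .
qed

lemma pmf_markov:
  fixes f :: "'a \<Rightarrow> real"
  assumes E: "(\<integral>\<^sup>+z. ennreal (f z) \<partial>measure_pmf M) \<le> ennreal B" and f: "\<And>z. f z \<ge> 0"
    and c: "c > 0" and B: "B \<ge> 0"
  shows "measure_pmf.prob M {z. f z < c} \<ge> 1 - B / c"
proof -
  have "ennreal (measure_pmf.prob M {z. f z \<ge> c}) = (\<integral>\<^sup>+z. indicator {z. f z \<ge> c} z \<partial>measure_pmf M)"
    by (simp add: measure_pmf.emeasure_eq_measure)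
  also have "\<dots> \<le> (\<integral>\<^sup>+z. ennreal (1 / c) * ennreal (f z) \<partial>measure_pmf M)"
    using c f by (intro nn_integral_mono)
      (auto simp: indicator_def ennreal_mult[symmetric] ennreal_1[symmetric] simp del: ennreal_1)
  also have "\<dots> = ennreal (1 / c) * (\<integral>\<^sup>+z. ennreal (f z) \<partial>measure_pmf M)" by (intro nn_integral_cmult) simp
  also have "\<dots> \<le> ennreal (1 / c) * ennreal B" by (intro mult_left_mono E) simp
  also have "\<dots> = ennreal (B / c)" using c B by (simp add: ennreal_mult[symmetric])
  finally have "measure_pmf.prob M {z. f z \<ge> c} \<le> B / c" using B c by simp
  moreover have "measure_pmf.prob M {z. f z < c} = 1 - measure_pmf.prob M {z. f z \<ge> c}"
    using measure_pmf.prob_compl[of "{z. f z \<ge> c}" M] by (simp add: Compl_eq_Diff_UNIV[symmetric] Collect_neg_eq[symmetric] not_le)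
  ultimately show ?thesis by linarith
qed

section \<open>Expected error in the Poisson model\<close>

text \<open>The counterpart of \<open>corr\<close> for an arbitrary graph, with no positivity
  assumed; the 2 undoes the half in \<open>tv_dist\<close>.\<close>

definition tv_corr :: "nat \<Rightarrow> 'o::finite fgraph \<Rightarrow> real" where
  "tv_corr n G = 2 / (real n)\<^sup>2 *
     (\<Sum>i<n. \<Sum>j<n. tv_dist (marg2 n G i j) (\<lambda>(s, t). marg n G i s * marg n G j t))"

lemma tv_dist_nonneg: "tv_dist p q \<ge> 0"
  by (simp add: tv_dist_def sum_nonneg)

lemma tv_corr_nonneg: "tv_corr n G \<ge> 0"
  unfolding tv_corr_def by (intro mult_nonneg_nonneg sum_nonneg tv_dist_nonneg) auto

lemma config_measure_gibbs:
  fixes G :: "'o::finite fgraph"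
  assumes n: "n > 0" and pos: "\<And>b \<sigma>. b \<in> set G \<Longrightarrow> fst b (map \<sigma> (snd b)) > 0"
  shows "config_measure n (gibbs n G)"
proof
  have w: "weight_of G \<sigma> > 0" for \<sigma>
    unfolding weight_of_def case_prod_unfold by (intro prod_list_pos pos)
  have "configs n \<noteq> ({} :: (nat \<Rightarrow> 'o) set)" by (simp add: configs_def PiE_eq_empty_iff)
  then have Z: "partition_fun n G > 0"
    unfolding partition_fun_def using w finite_configs by (intro sum_pos) auto
  show "gibbs n G \<sigma> \<ge> 0" for \<sigma> using w[of \<sigma>] Z by (simp add: gibbs_def)
  show "(\<Sum>\<sigma>\<in>configs n. gibbs n G \<sigma>) = 1"
    using Z by (simp add: gibbs_def sum_divide_distrib[symmetric] partition_fun_def)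
qed (rule n)

context
  fixes n :: nat and G :: "'o::finite fgraph"
  assumes cm: "config_measure n (gibbs n G)"
begin

interpretation config_measure n "gibbs n G" by (rule cm)

lemma tv_dist_eq_cov:
  "tv_dist (marg2 n G i j) (\<lambda>(s, t). marg n G i s * marg n G j t)
    = (\<Sum>s\<in>UNIV. \<Sum>t\<in>UNIV. \<bar>cov (spin i s) (spin j t)\<bar>) / 2"
proof -
  have 1: "ex (spin i s) = marg n G i s" for i s
    unfolding ex_def marg_def spin_def by (intro sum.cong) auto
  have 2: "ex (\<lambda>\<sigma>. spin i s \<sigma> * spin j t \<sigma>) = marg2 n G i j (s, t)" for s t
    unfolding ex_def marg2_def spin_def by (intro sum.cong) auto
  show ?thesis
    unfolding tv_dist_def cov_def 1 2 sum.cartesian_product UNIV_Times_UNIV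
    by (simp add: case_prod_unfold)
qed

lemma corr_eq_tv_corr: "config_measure.corr n (gibbs n G) = tv_corr n G"
  unfolding corr_def tv_corr_def tv_dist_eq_cov by (simp add: sum_divide_distrib[symmetric])

text \<open>A crude bound whose purpose is integrability.\<close>

lemma tv_dist_marg_le:
  "tv_dist (marg2 n G i j) (\<lambda>(s, t). marg n G i s * marg n G j t) \<le> (real CARD('o))\<^sup>2"
proof -
  have "\<bar>cov (spin i s) (spin j t)\<bar> \<le> 2" for s t
  proof -
    have "\<bar>ex (\<lambda>\<sigma>. spin i s \<sigma> * spin j t \<sigma>)\<bar> \<le> 1" by (intro abs_ex_le) (simp add: spin_def)
    moreover have "\<bar>ex (spin i s)\<bar> \<le> 1" "\<bar>ex (spin j t)\<bar> \<le> 1" by (auto intro!: abs_ex_le simp: spin_def)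
    then have "\<bar>ex (spin i s) * ex (spin j t)\<bar> \<le> 1" by (simp add: abs_mult mult_le_one)
    ultimately show ?thesis unfolding cov_def by linarith
  qed
  then have "(\<Sum>s\<in>(UNIV::'o set). \<Sum>t\<in>(UNIV::'o set). \<bar>cov (spin i s) (spin j t)\<bar>)
      \<le> (\<Sum>s\<in>(UNIV::'o set). \<Sum>t\<in>(UNIV::'o set). 2)" by (intro sum_mono)
  then show ?thesis unfolding tv_dist_eq_cov by (simp add: power2_eq_square)
qed

end

lemma set_random_fgraph:
  "G \<in> set_pmf (random_fgraph d k \<rho> n) \<Longrightarrow> set G \<subseteq> set_pmf (pair_pmf \<rho> (random_tuple n k))"
  unfolding random_fgraph_def by (auto simp: set_replicate_pmf lists_eq_set)

lemma sum_exp_le: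
  assumes "(x::real) \<ge> 0"
  shows "(\<Sum>r<N. x ^ r / fact r) \<le> exp x"
  using sum_le_suminf[OF summable_exp[of x], of "{..<N}"] assms
  by (simp add: exp_def divide_inverse mult.commute)

locale poisson_model =
  fixes n k :: nat and d lo hi :: real and \<rho> :: "'o::finite weight pmf"
  assumes n_pos: "n > 0" and k_pos: "k > 0" and d_pos: "d > 0"
    and lo: "0 < lo" "lo \<le> 1" and hi: "1 \<le> hi"
    and fin_rho: "finite (set_pmf \<rho>)"
    and weight_bounds: "\<And>\<psi> \<tau>. \<psi> \<in> set_pmf \<rho> \<Longrightarrow> length \<tau> = k \<Longrightarrow> lo \<le> \<psi> \<tau> \<and> \<psi> \<tau> \<le> hi"
begin

abbreviation "P \<equiv> pair_pmf \<rho> (random_tuple n k)"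
abbreviation "l \<equiv> d * real n / real k"

lemma fin_P: "finite (set_pmf P)"
  using finite_lists_length_eq[of "{..<n}" k] fin_rho
  by (simp add: set_random_tuple[OF n_pos] conj_commute)

lemma cm:
  assumes "set G \<subseteq> set_pmf P"
  shows "config_measure n (gibbs n G)"
proof (rule config_measure_gibbs[OF n_pos])
  fix b and \<sigma> :: "nat \<Rightarrow> 'o" assume "b \<in> set G"
  then have "b \<in> set_pmf P" using assms by blast
  then have "fst b \<in> set_pmf \<rho>" "length (map \<sigma> (snd b)) = k"
    by (auto simp: set_random_tuple[OF n_pos])
  then show "fst b (map \<sigma> (snd b)) > 0" using weight_bounds lo(1) by fastforce
qed

lemma sum_lavg_tv_corr_le:
  "(\<Sum>m<N. l ^ m / fact m * exp (- l) * lavg P m (tv_corr n))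
    \<le> 2 * (1 / (real n)\<^sup>2 * (\<Sum>i<n. \<Sum>j<n. measure_pmf.expectation (random_fgraph d k \<rho> n)
        (\<lambda>G. tv_dist (marg2 n G i j) (\<lambda>(s, t). marg n G i s * marg n G j t))))"
proof -
  let ?M = "random_fgraph d k \<rho> n"
  let ?T = "\<lambda>i j G. tv_dist (marg2 n G i j) (\<lambda>(s, t). marg n G i s * marg n G j t)"
  let ?b = "2 * (1 / (real n)\<^sup>2 * (\<Sum>i<n. \<Sum>j<n. measure_pmf.expectation ?M (?T i j)))"
  have int: "integrable (measure_pmf ?M) (?T i j)" for i j
  proof (rule measure_pmf.integrable_const_bound)
    show "AE G in measure_pmf ?M. norm (?T i j G) \<le> (real CARD('o))\<^sup>2"
      unfolding AE_measure_pmf_iff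
    proof
      fix G assume "G \<in> set_pmf ?M"
      then have "?T i j G \<le> (real CARD('o))\<^sup>2" by (intro tv_dist_marg_le cm set_random_fgraph)
      then show "norm (?T i j G) \<le> (real CARD('o))\<^sup>2" by (simp add: tv_dist_nonneg)
    qed
  qed simp
  have b: "measure_pmf.expectation ?M (tv_corr n) = ?b"
    unfolding tv_corr_def[abs_def] using int by simp
  have intc: "integrable (measure_pmf ?M) (tv_corr n)"
    unfolding tv_corr_def[abs_def] using int by simp
  have "ennreal (\<Sum>m<N. l ^ m / fact m * exp (- l) * lavg P m (tv_corr n))
      \<le> (SUP N. ennreal (\<Sum>m<N. l ^ m / fact m * exp (- l) * lavg P m (tv_corr n)))"
    by (rule SUP_upper) simp
  also have "\<dots> = (\<integral>\<^sup>+G. ennreal (tv_corr n G) \<partial>?M)"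
    unfolding random_fgraph_def using d_pos n_pos k_pos
    by (intro nn_integral_poisson_list[symmetric] fin_P tv_corr_nonneg) auto
  also have "\<dots> = ennreal ?b"
    unfolding b[symmetric] by (intro nn_integral_eq_integral intc) (simp add: tv_corr_nonneg)
  finally have "ennreal (\<Sum>m<N. l ^ m / fact m * exp (- l) * lavg P m (tv_corr n)) \<le> ennreal ?b" .
  moreover have "?b \<ge> 0"
    by (intro mult_nonneg_nonneg sum_nonneg integral_nonneg) (auto simp: tv_dist_nonneg)
  ultimately show ?thesis by (simp only: ennreal_le_iff)
qed

text \<open>The constants \<open>M\<close> and \<open>D\<close> of \<open>bp_setting\<close> and \<open>gibbs_setting\<close>, visibly independent of \<open>n\<close>, \<open>x\<close> and the graph.\<close>

definition C1 :: real where "C1 = 1 + d * hi + 2 * hi * d * k * real CARD('o) ^ k"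
definition C2 :: real where
  "C2 = 2 * real CARD('o) * d + 2 / lo * hi * d * k * (real CARD('o) * real CARD('o) ^ k + real CARD('o) ^ 2)"
text \<open>The value of the series of \<open>C2 * (4 * (C1 / lo)) ^ r / fact r\<close>, as required
  by the thinning bound.\<close>

definition C :: real where "C = C2 * exp (4 * (C1 / lo))"

lemma C_nonneg: "C1 \<ge> 0" "C2 \<ge> 0" "C \<ge> 0"
  unfolding C_def C1_def C2_def using lo hi d_pos by auto

lemma hit_sum_local_err:
  assumes x: "x < n" and G: "set G \<subseteq> set_pmf P" "\<forall>b\<in>set G. x \<notin> set (snd b)"
  shows "l ^ r * lavg P r (\<lambda>c. of_bool (\<forall>b\<in>set c. x \<in> set (snd b)) * (\<Sum>b\<leftarrow>c. local_err n x b (remove1 b c) G))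
     \<le> C2 * (4 * (C1 / lo)) ^ r * sqrt (tv_corr n G)"
proof -
  interpret C: config_measure n "gibbs n G" by (rule cm[OF G(1)])
  interpret B: gibbs_setting n G k d lo hi \<rho> x
    by unfold_locales (use k_pos d_pos lo hi fin_rho weight_bounds x G in auto)
  show ?thesis
    using B.hit_sum_local_err[of r]
    unfolding B.M_def B.D_def C1_def[symmetric] C2_def[symmetric] corr_eq_tv_corr[OF cm[OF G(1)]] .
qed

lemma sum_lavg_bp_error_le:
  "(\<Sum>m<N. l ^ m / fact m * exp (- l) * lavg P m (bp_error n))
    \<le> real n * (C * (\<Sum>m<N. l ^ m / fact m * exp (- l) * lavg P m (\<lambda>G. sqrt (tv_corr n G))))"
proof -
  let ?\<Phi> = "\<lambda>x c G. \<Sum>b\<leftarrow>c. local_err n x b (remove1 b c) G"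
  let ?F = "\<lambda>x G. ?\<Phi> x (filter (\<lambda>b. x \<in> set (snd b)) G) (filter (\<lambda>b. x \<notin> set (snd b)) G)"
  let ?w = "\<lambda>m. l ^ m / fact m :: real"
  let ?S = "\<Sum>m<N. ?w m * lavg P m (\<lambda>G. sqrt (tv_corr n G))"
  have x: "(\<Sum>m<N. ?w m * lavg P m (?F x)) \<le> C * ?S" if "x < n" for x
  proof (rule poisson_thinning_bound[where \<Phi> = "?\<Phi> x" and Q = "\<lambda>b. x \<in> set (snd b)"
        and a = "\<lambda>r. C2 * (4 * (C1 / lo)) ^ r"])
    show "(\<Sum>r<N. C2 * (4 * (C1 / lo)) ^ r / fact r) \<le> C" for N
      using sum_exp_le[of "4 * (C1 / lo)" N] C_nonneg lo
      by (auto simp: C_def sum_distrib_left[symmetric] simp flip: times_divide_eq_right intro!: mult_left_mono)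
    show "\<And>r G. set G \<subseteq> set_pmf P \<Longrightarrow> \<forall>b\<in>set G. x \<notin> set (snd b) \<Longrightarrow>
        l ^ r * lavg P r (\<lambda>c. of_bool (\<forall>b\<in>set c. x \<in> set (snd b)) * ?\<Phi> x c G)
        \<le> C2 * (4 * (C1 / lo)) ^ r * sqrt (tv_corr n G)"
      by (rule hit_sum_local_err[OF that])
  qed (use d_pos C_nonneg lo in \<open>auto intro!: sum_list_nonneg local_err_nonneg tv_corr_nonneg\<close>)
  have eq: "(bp_error n :: 'o fgraph \<Rightarrow> real) = (\<lambda>G. \<Sum>x<n. ?F x G)"
    by (rule ext) (rule bp_error_eq_sum_local_err)
  have "(\<Sum>m<N. ?w m * lavg P m (bp_error n)) = (\<Sum>x<n. \<Sum>m<N. ?w m * lavg P m (?F x))"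
    unfolding eq lavg_sum sum_distrib_left by (rule sum.swap)
  also have "\<dots> \<le> (\<Sum>x<n. C * ?S)" by (intro sum_mono x) auto
  finally have "exp (- l) * (\<Sum>m<N. ?w m * lavg P m (bp_error n)) \<le> exp (- l) * (real n * (C * ?S))"
    by (intro mult_left_mono) auto
  then show ?thesis by (simp add: sum_distrib_left mult_ac)
qed

text \<open>The root of \<open>tv_corr\<close> is at most
  \<open>tv_corr / (2 * \<eta>) + \<eta> / 2\<close>, which is linear in the controlled quantity.
  Since \<open>\<beta> \<le> \<eta>\<^sup>2\<close>, both halves average to at most
  \<open>\<eta> / 2\<close>.\<close>

lemma expected_bp_error_le:
  defines "\<beta> \<equiv> 2 * (1 / (real n)\<^sup>2 * (\<Sum>i<n. \<Sum>j<n. measure_pmf.expectation (random_fgraph d k \<rho> n)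
        (\<lambda>G. tv_dist (marg2 n G i j) (\<lambda>(s, t). marg n G i s * marg n G j t))))"
  assumes \<eta>: "\<eta> > 0" "\<beta> \<le> \<eta>\<^sup>2"
  shows "(\<integral>\<^sup>+G. ennreal (bp_error n G) \<partial>random_fgraph d k \<rho> n) \<le> ennreal (real n * (C * \<eta>))"
proof -
  let ?w = "\<lambda>m. l ^ m / fact m * exp (- l) :: real"
  have l: "l > 0" using d_pos n_pos k_pos by simp
  have w: "?w m \<ge> 0" for m using l by simp
  have w1: "(\<Sum>m<N. ?w m) \<le> 1" for N
  proof -
    have "(\<Sum>m<N. ?w m) = (\<Sum>m<N. l ^ m / fact m) * exp (- l)" by (simp only: sum_distrib_right)
    also have "\<dots> \<le> exp l * exp (- l)" using l by (intro mult_right_mono sum_exp_le) auto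
    finally show ?thesis by (simp add: exp_minus)
  qed
  have "(\<Sum>m<N. ?w m * lavg P m (bp_error n)) \<le> real n * (C * \<eta>)" for N
  proof -
    have "(\<Sum>m<N. ?w m * lavg P m (\<lambda>G. sqrt (tv_corr n G)))
        \<le> (\<Sum>m<N. ?w m * lavg P m (\<lambda>G. 1 / (2 * \<eta>) * tv_corr n G + \<eta> / 2))"
    proof (intro sum_mono mult_left_mono lavg_mono w)
      fix G :: "'o fgraph"
      have "0 \<le> (sqrt (tv_corr n G) - \<eta>)\<^sup>2" by simp
      then have "2 * \<eta> * sqrt (tv_corr n G) \<le> tv_corr n G + \<eta>\<^sup>2"
        by (simp add: power2_diff tv_corr_nonneg mult_ac)
      then show "sqrt (tv_corr n G) \<le> 1 / (2 * \<eta>) * tv_corr n G + \<eta> / 2"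
        using \<eta>(1) by (simp add: field_simps power2_eq_square)
    qed
    also have "\<dots> = 1 / (2 * \<eta>) * (\<Sum>m<N. ?w m * lavg P m (tv_corr n)) + \<eta> / 2 * (\<Sum>m<N. ?w m)"
      unfolding lavg_add lavg_cmult lavg_const[OF fin_P]
      by (simp only: distrib_left sum.distrib sum_distrib_left mult_ac)
    also have "\<dots> \<le> 1 / (2 * \<eta>) * \<eta>\<^sup>2 + \<eta> / 2 * 1"
      using sum_lavg_tv_corr_le[of N, folded \<beta>_def] \<eta> w1 by (intro add_mono mult_left_mono) auto
    also have "\<dots> = \<eta>" using \<eta>(1) by (simp add: power2_eq_square)
    finally have "real n * (C * (\<Sum>m<N. ?w m * lavg P m (\<lambda>G. sqrt (tv_corr n G)))) \<le> real n * (C * \<eta>)"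
      using C_nonneg by (intro mult_left_mono) auto
    then show ?thesis using sum_lavg_bp_error_le[of N] by linarith
  qed
  then show ?thesis unfolding random_fgraph_def
    by (subst nn_integral_poisson_list[OF fin_P l bp_error_nonneg]) (auto intro!: SUP_least ennreal_leI)
qed

text \<open>The mean error per variable is of order \<open>\<eta>\<close>; the threshold
  \<open>sqrt \<eta>\<close> divides it evenly between tolerance and failure probability.\<close>

lemma prob_bp_fixed_point_ge:
  defines "\<beta> \<equiv> 2 * (1 / (real n)\<^sup>2 * (\<Sum>i<n. \<Sum>j<n. measure_pmf.expectation (random_fgraph d k \<rho> n)
        (\<lambda>G. tv_dist (marg2 n G i j) (\<lambda>(s, t). marg n G i s * marg n G j t))))"
  assumes \<eta>: "\<eta> > 0" "\<beta> \<le> \<eta>\<^sup>2"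
  shows "1 - C * sqrt \<eta> \<le> measure_pmf.prob (random_fgraph d k \<rho> n) {G. is_eps_BP_fixed_point n G (sqrt \<eta>)}"
proof -
  have "1 - real n * (C * \<eta>) / (sqrt \<eta> * real n)
      \<le> measure_pmf.prob (random_fgraph d k \<rho> n) {G. bp_error n G < sqrt \<eta> * real n}"
    using expected_bp_error_le[OF \<eta>[unfolded \<beta>_def]] \<eta>(1) n_pos C_nonneg
    by (intro pmf_markov bp_error_nonneg) auto
  also have "real n * (C * \<eta>) / (sqrt \<eta> * real n) = C * sqrt \<eta>"
    using n_pos \<eta>(1) by (simp add: field_simps)
  finally show ?thesis by (simp add: is_eps_BP_fixed_point_def)
qed

end

theorem theorem1:
  fixes d :: real and k :: nat
    and \<Psi> :: "('o::finite) weight set" and \<rho> :: "'o weight pmf"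
  assumes "d > 0" and "k \<ge> 3"
    and "finite \<Psi>" and "\<Psi> \<noteq> {}"
    and "\<And>\<psi> \<tau>. \<psi> \<in> \<Psi> \<Longrightarrow> length \<tau> = k \<Longrightarrow> \<psi> \<tau> > 0"
    and "set_pmf \<rho> \<subseteq> \<Psi>"
    and RS: "(\<lambda>n. (1 / (real n)^2) *
              (\<Sum>i<n. \<Sum>j<n. measure_pmf.expectation (random_fgraph d k \<rho> n)
                 (\<lambda>G. tv_dist (marg2 n G i j) (\<lambda>(s, t). marg n G i s * marg n G j t))))
            \<longlonglongrightarrow> 0"
  shows "\<exists>\<epsilon> :: nat \<Rightarrow> real. \<epsilon> \<longlonglongrightarrow> 0 \<and>
           (\<lambda>n. measure_pmf.prob (random_fgraph d k \<rho> n)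
                  {G. is_eps_BP_fixed_point n G (\<epsilon> n)}) \<longlonglongrightarrow> 1"
proof -
  \<comment> \<open>Inserting 1 forces \<open>lo \<le> 1\<close> and
    \<open>1 \<le> hi\<close>.\<close>
  define V where "V = insert 1 ((\<lambda>(\<psi>, \<tau>). \<psi> \<tau>) ` (\<Psi> \<times> {\<tau> :: 'o list. length \<tau> = k}))"
  have V: "finite V"
    unfolding V_def using \<open>finite \<Psi>\<close> finite_lists_length_eq[of "UNIV :: 'o set" k] by simp
  define lo hi where "lo = Min V" and "hi = Max V"
  have lohi: "lo \<le> v" "v \<le> hi" if "v \<in> V" for v
    using that V by (auto simp: lo_def hi_def)
  have "lo \<in> V" unfolding lo_def using V by (intro Min_in) (auto simp: V_def)
  then have lo_pos: "lo > 0" using assms(5) by (auto simp: V_def)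
  have one: "1 \<in> V" by (simp add: V_def)
  have bounds: "lo \<le> \<psi> \<tau> \<and> \<psi> \<tau> \<le> hi" if "\<psi> \<in> set_pmf \<rho>" "length \<tau> = k" for \<psi> \<tau>
  proof -
    have "(\<psi>, \<tau>) \<in> \<Psi> \<times> {\<tau> :: 'o list. length \<tau> = k}" using that \<open>set_pmf \<rho> \<subseteq> \<Psi>\<close> by auto
    then have "\<psi> \<tau> \<in> V" unfolding V_def by force
    then show ?thesis using lohi by auto
  qed
  have fin: "finite (set_pmf \<rho>)" by (rule finite_subset[OF assms(6,3)])
  have model: "poisson_model n k d lo hi \<rho>" if "n > 0" for n
    by unfold_locales (use that assms(1,2) lo_pos lohi[OF one] bounds fin in auto)
  define \<beta> where "\<beta> n = 2 * (1 / (real n)\<^sup>2 * (\<Sum>i<n. \<Sum>j<n. measure_pmf.expectation (random_fgraph d k \<rho> n)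
        (\<lambda>G. tv_dist (marg2 n G i j) (\<lambda>(s, t). marg n G i s * marg n G j t))))" for n
  have \<beta>0: "\<beta> n \<ge> 0" for n
    unfolding \<beta>_def by (intro mult_nonneg_nonneg sum_nonneg integral_nonneg) (auto simp: tv_dist_nonneg)
  \<comment> \<open>The summand \<open>1 / real n\<close> keeps \<open>\<eta> n\<close> positive for
    \<open>n > 0\<close> even if \<open>\<beta> n\<close> vanishes, and it does not affect the
    limit.\<close>
  define \<eta> where "\<eta> n = sqrt (\<beta> n + 1 / real n)" for n
  have "\<beta> \<longlonglongrightarrow> 2 * 0" unfolding \<beta>_def by (intro tendsto_mult tendsto_const RS)
  then have "(\<lambda>n. \<beta> n + 1 / real n) \<longlonglongrightarrow> 2 * 0 + 0" by (intro tendsto_add lim_1_over_n)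
  from tendsto_real_sqrt[OF this] have \<eta>_lim: "\<eta> \<longlonglongrightarrow> 0" by (simp add: \<eta>_def[abs_def])
  have \<epsilon>_lim: "(\<lambda>n. sqrt (\<eta> n)) \<longlonglongrightarrow> 0" using tendsto_real_sqrt[OF \<eta>_lim] by simp
  \<comment> \<open>The constant does not take \<open>n\<close> as an argument, so the failure bound
    tends to 0 along with \<open>\<eta>\<close>.\<close>
  define K where "K = poisson_model.C TYPE('o) k d lo hi"
  have ge: "1 - K * sqrt (\<eta> n) \<le> measure_pmf.prob (random_fgraph d k \<rho> n) {G. is_eps_BP_fixed_point n G (sqrt (\<eta> n))}"
    if "n > 0" for n
  proof -
    interpret poisson_model n k d lo hi \<rho> by (rule model[OF that])
    have "\<beta> n + 1 / real n > 0" using \<beta>0[of n] that by (simp add: add_nonneg_pos)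
    then have "\<eta> n > 0" "\<beta> n \<le> (\<eta> n)\<^sup>2" by (simp_all add: \<eta>_def)
    then show ?thesis unfolding K_def \<beta>_def by (rule prob_bp_fixed_point_ge)
  qed
  have "(\<lambda>n. 1 - K * sqrt (\<eta> n)) \<longlonglongrightarrow> 1 - K * 0"
    by (intro tendsto_diff tendsto_mult tendsto_const \<epsilon>_lim)
  then have lower: "(\<lambda>n. 1 - K * sqrt (\<eta> n)) \<longlonglongrightarrow> 1" by simp
  have "(\<lambda>n. measure_pmf.prob (random_fgraph d k \<rho> n) {G. is_eps_BP_fixed_point n G (sqrt (\<eta> n))}) \<longlonglongrightarrow> 1"
  proof (rule tendsto_sandwich[OF _ _ lower tendsto_const])
    show "\<forall>\<^sub>F n in sequentially. 1 - K * sqrt (\<eta> n)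
        \<le> measure_pmf.prob (random_fgraph d k \<rho> n) {G. is_eps_BP_fixed_point n G (sqrt (\<eta> n))}"
      by (rule eventually_sequentiallyI[of 1], rule ge) simp
    show "\<forall>\<^sub>F n in sequentially.
        measure_pmf.prob (random_fgraph d k \<rho> n) {G. is_eps_BP_fixed_point n G (sqrt (\<eta> n))} \<le> 1"
      by (intro always_eventually allI measure_pmf.prob_le_1)
  qed
  then show ?thesis using \<epsilon>_lim by blast
qed

end
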